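(* Let $\mathbf d=(d_1,\dots,d_m)$ and $\ell\ge1$. (i) (Recursive system.) Let $\mathcal C_{\mathrm{rec}}$ be the set of all $\mathbf y$ for which there exist Hermitian matrices $\mathbf X_k\in\mathbb S^{d_k}$ ($k\in[m]$) and $\mathbf Z_k\in\mathbb S^{d_{[k]}}$ ($k\in[m]$) with $\mathbf Z_m=\mathbf y$, $\mathbf Z_1=\mathbf X_1$, $\mathbf X_k\succeq0$ and $\mathrm{Tr}(\mathbf X_k)=1$ for all $k\in[m]$, and, for all $k\in\{2,\dots,m\}$: $\mathrm{Tr}(\mathbf Z_k)=1$, $\mathbf Z_k\in\mathrm{DPS}_\ell((d_{[k-1]},d_k))$, $\mathrm{Tr}_{\mathbf X_k}(\mathbf Z_k)=\mathbf Z_{k-1}$, and $\mathrm{Tr}_{\mathbf Z_{k-1}}(\mathbf Z_k)=\mathbf X_k$. (ii) (Dichotomy system.) Let $T=(S,E)$ be a rooted ordered binary tree with root $k_0$ in which every internal node $k$ has exactly two subnodes $k_A$ (left) and $k_B$ (right), and whose leaves, read from left to right, are $S'=[m]$. Let $\mathcal C_{T}$ be the set of all $\mathbf y$ for which there exist Hermitian matrices $\mathbf Z_k\in\mathbb S^{d_k}$ ($k\in S$) and $\mathbf X_k\in\mathbb S^{d_k}$ ($k\in S'$) with $\mathbf Z_{k_0}=\mathbf y$, $\mathbf Z_k=\mathbf X_k$ for all $k\in S'$, $\mathbf Z_k\succeq0$ and $\mathrm{Tr}(\mathbf Z_k)=1$ for all $k\in S$, and, for all $k\in S\setminus S'$: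 $\mathbf Z_k\in\mathrm{DPS}_\ell((d_{k_A},d_{k_B}))$, $\mathrm{Tr}_{\mathbf Z_{k_A}}(\mathbf Z_k)=\mathbf Z_{k_B}$, and $\mathrm{Tr}_{\mathbf Z_{k_B}}(\mathbf Z_k)=\mathbf Z_{k_A}$. Then $\mathcal C_{\mathrm{rec}}$ and $\mathcal C_T$ are both convex outer approximations of the set of separable multipartite states, i.e. both are convex and contain $\mathrm{Sep}(\mathbf d)$.
   Context: $\mathbb S^d$ is the space of complex Hermitian $d\times d$ matrices and $\mathbb D^d$ the set of density matrices (positive semidefinite, trace one) in it. $d_{[h]}=\prod_{k\in[h]}d_k$ and $\bar d=d_{[m]}$. For an internal node $k$ of the tree, $d_k=d_{k_A}d_{k_B}$ (so $d_{k_0}=\bar d$). $\mathrm{Sep}(\mathbf d)$ is the set of trace-one elements of the cone of all finite sums $\sum_i\mathbf x_{i1}\mathbf x_{i1}^\dagger\otimes\cdots\otimes\mathbf x_{im}\mathbf x_{im}^\dagger$ with $\mathbf x_{ij}\in\mathbb C^{d_j}$, viewed as $\bar d\times\bar d$ Hermitian matrices. For $\mathbf Z_k$ acting on $\mathbb C^{d_{[k-1]}}\otimes\mathbb C^{d_k}$, $\mathrm{Tr}_{\mathbf X_k}$ denotes the partial trace over the second factor and $\mathrm{Tr}_{\mathbf Z_{k-1}}$ the partial trace over the first factor; for $\mathbf Z_k$ acting on $\mathbb C^{d_{k_A}}\otimes\mathbb C^{d_{k_B}}$, $\mathrm{Tr}_{\mathbf Z_{k_A}}$ and $\mathrm{Tr}_{\mathbf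 Z_{k_B}}$ denote the partial traces over the first and second factor respectively. For $(d_A,d_B)$ and $\ell\ge1$, $\mathrm{DPS}_\ell((d_A,d_B))$ is the set of all $w\in\mathbb D^{d_Ad_B}$ (acting on $\mathbb C^{d_A}\otimes\mathbb C^{d_B}$) for which there is a Hermitian matrix $\rho$ acting on $\mathbb C^{d_A}\otimes(\mathbb C^{d_B})^{\otimes\ell}$ such that: (a) $\rho\succeq0$; (b) tracing out the copies $2,\dots,\ell$ of subsystem $B$ from $\rho$ gives $w$; (c) $(\mathrm{Id}\otimes\Pi)\rho(\mathrm{Id}\otimes\Pi)=\rho$, where $\Pi$ is the orthogonal projector onto the symmetric subspace of $(\mathbb C^{d_B})^{\otimes\ell}$; (d) for each $s=1,\dots,\ell$ and any choice of $s$ copies of $B$, the partial transpose of $\rho$ on those copies is positive semidefinite. *)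

theory Defs
  imports
    Complex_Main
    "HOL-Combinatorics.Permutations"
    "Jordan_Normal_Form.Schur_Decomposition"
begin

definition herm :: "nat \<Rightarrow> complex mat set" where
  "herm n = {A \<in> carrier_mat n n. mat_adjoint A = A}"

text \<open>\<open>(A *\<^sub>v v) \<bullet>c v\<close> is \<open>v\<^sup>\<dagger> A v\<close>, a real number for Hermitian \<open>A\<close>.\<close>

definition psd :: "complex mat \<Rightarrow> bool" where
  "psd A \<longleftrightarrow> A \<in> herm (dim_row A) \<and>
     (\<forall>v \<in> carrier_vec (dim_row A). 0 \<le> Re ((A *\<^sub>v v) \<bullet>c v))"

definition mat_trace :: "'a::comm_monoid_add mat \<Rightarrow> 'a" where
  "mat_trace A = (\<Sum>i<dim_row A. A $$ (i, i))"

definition density :: "nat \<Rightarrow> complex mat set" where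
  "density n = {A \<in> herm n. psd A \<and> mat_trace A = 1}"

text \<open>The type of matrices of arbitrary dimensions is not a real vector space, so
  the library constant \<open>convex\<close> does not apply to it.\<close>

definition mat_convex :: "complex mat set \<Rightarrow> bool" where
  "mat_convex C \<longleftrightarrow> (\<forall>A \<in> C. \<forall>B \<in> C. \<forall>t::real. 0 \<le> t \<and> t \<le> 1 \<longrightarrow>
     complex_of_real (1 - t) \<cdot>\<^sub>m A + complex_of_real t \<cdot>\<^sub>m B \<in> C)"

text \<open>The basis vector \<open>e\<^sub>i \<otimes> e\<^sub>j\<close> of the tensor product of spaces of dimensions
  \<open>a\<close> and \<open>b\<close> has index \<open>i * b + j\<close>.\<close>

definition kron :: "complex mat \<Rightarrow> complex mat \<Rightarrow> complex mat" where
  "kron A B = mat (dim_row A * dim_row B) (dim_col A * dim_col B)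
     (\<lambda>(i, j). A $$ (i div dim_row B, j div dim_col B) *
                B $$ (i mod dim_row B, j mod dim_col B))"

text \<open>\<open>kron_upto A m\<close> is \<open>A 1 \<otimes> \<dots> \<otimes> A m\<close>.\<close>

primrec kron_upto :: "(nat \<Rightarrow> complex mat) \<Rightarrow> nat \<Rightarrow> complex mat" where
  "kron_upto A 0 = 1\<^sub>m 1"
| "kron_upto A (Suc n) = kron (kron_upto A n) (A (Suc n))"

definition ptrace_fst :: "nat \<Rightarrow> nat \<Rightarrow> complex mat \<Rightarrow> complex mat" where
  "ptrace_fst a b Z = mat b b (\<lambda>(i, j). \<Sum>k<a. Z $$ (k * b + i, k * b + j))"

definition ptrace_snd :: "nat \<Rightarrow> nat \<Rightarrow> complex mat \<Rightarrow> complex mat" where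
  "ptrace_snd a b Z = mat a a (\<lambda>(i, j). \<Sum>k<b. Z $$ (i * b + k, j * b + k))"

definition prefix_dim :: "(nat \<Rightarrow> nat) \<Rightarrow> nat \<Rightarrow> nat" where
  "prefix_dim d h = (\<Prod>k=1..h. d k)"

definition outer :: "complex vec \<Rightarrow> complex mat" where
  "outer x = mat (dim_vec x) (dim_vec x) (\<lambda>(i, j). x $ i * cnj (x $ j))"

definition sep_cone :: "(nat \<Rightarrow> nat) \<Rightarrow> nat \<Rightarrow> complex mat set" where
  "sep_cone d m = {W. \<exists>(N::nat) (x :: nat \<Rightarrow> nat \<Rightarrow> complex vec).
     (\<forall>i<N. \<forall>j\<in>{1..m}. x i j \<in> carrier_vec (d j)) \<and>
     W = mat (prefix_dim d m) (prefix_dim d m)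
           (\<lambda>(r, s). \<Sum>i<N. kron_upto (\<lambda>j. outer (x i j)) m $$ (r, s))}"

definition Sep :: "(nat \<Rightarrow> nat) \<Rightarrow> nat \<Rightarrow> complex mat set" where
  "Sep d m = {W \<in> sep_cone d m. mat_trace W = 1}"

text \<open>A basis vector \<open>e\<^bsub>i_1\<^esub> \<otimes> \<dots> \<otimes> e\<^bsub>i_n\<^esub>\<close> of the \<open>n\<close>-fold tensor power of a space of
  dimension \<open>b\<close> has as index the number with base-\<open>b\<close> digits \<open>i_1, \<dots>, i_n\<close>, most
  significant first, in accordance with \<open>kron\<close>.\<close>

definition digit :: "nat \<Rightarrow> nat \<Rightarrow> nat \<Rightarrow> nat \<Rightarrow> nat" where
  "digit b n i s = (i div b ^ (n - s)) mod b"

definition undigits :: "nat \<Rightarrow> nat \<Rightarrow> (nat \<Rightarrow> nat) \<Rightarrow> nat" where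
  "undigits b n f = (\<Sum>s=1..n. f s * b ^ (n - s))"

definition permute_factors :: "nat \<Rightarrow> nat \<Rightarrow> (nat \<Rightarrow> nat) \<Rightarrow> complex vec \<Rightarrow> complex vec" where
  "permute_factors b n \<sigma> v =
     vec (b ^ n) (\<lambda>i. v $ undigits b n (\<lambda>s. digit b n i (\<sigma> s)))"

definition sym_subspace :: "nat \<Rightarrow> nat \<Rightarrow> complex vec set" where
  "sym_subspace b n =
     {v \<in> carrier_vec (b ^ n). \<forall>\<sigma>. \<sigma> permutes {1..n} \<longrightarrow> permute_factors b n \<sigma> v = v}"

definition is_orth_projector :: "nat \<Rightarrow> complex vec set \<Rightarrow> complex mat \<Rightarrow> bool" where
  "is_orth_projector n V P \<longleftrightarrow> P \<in> carrier_mat n n \<and>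
     (\<forall>v \<in> carrier_vec n. P *\<^sub>v v \<in> V \<and> (\<forall>u \<in> V. (v - P *\<^sub>v v) \<bullet>c u = 0))"

definition sym_projector :: "nat \<Rightarrow> nat \<Rightarrow> complex mat" where
  "sym_projector b n = (THE P. is_orth_projector (b ^ n) (sym_subspace b n) P)"

text \<open>Partial transpose of a matrix acting on the tensor product of a space of dimension \<open>a\<close>
  and \<open>n\<close> copies of a space of dimension \<open>b\<close>, with respect to the copies in
  \<open>I \<subseteq> {1..n}\<close>: row and column digits are exchanged at the positions in \<open>I\<close>.\<close>

definition mix_digits :: "nat \<Rightarrow> nat \<Rightarrow> nat set \<Rightarrow> nat \<Rightarrow> nat \<Rightarrow> nat" where
  "mix_digits b n I i j =
     (i div b ^ n) * b ^ n + undigits b n (\<lambda>s. if s \<in> I then digit b n j s else digit b n i s)"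

definition ptranspose :: "nat \<Rightarrow> nat \<Rightarrow> nat \<Rightarrow> nat set \<Rightarrow> complex mat \<Rightarrow> complex mat" where
  "ptranspose a b n I \<rho> = mat (a * b ^ n) (a * b ^ n)
     (\<lambda>(i, j). \<rho> $$ (mix_digits b n I i j, mix_digits b n I j i))"

text \<open>The marginal on the first factor and the first copy of the second factor is
  \<open>ptrace_snd (a * b) (b ^ (l - 1)) \<rho>\<close>, the last \<open>l - 1\<close> copies being the least
  significant digits.\<close>

definition DPS :: "nat \<Rightarrow> nat \<Rightarrow> nat \<Rightarrow> complex mat set" where
  "DPS l a b = {w \<in> density (a * b). \<exists>\<rho> \<in> herm (a * b ^ l).
     psd \<rho> \<and>
     ptrace_snd (a * b) (b ^ (l - 1)) \<rho> = w \<and>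
     kron (1\<^sub>m a) (sym_projector b l) * \<rho> * kron (1\<^sub>m a) (sym_projector b l) = \<rho> \<and>
     (\<forall>I. I \<subseteq> {1..l} \<and> I \<noteq> {} \<longrightarrow> psd (ptranspose a b l I \<rho>))}"

definition C_rec :: "(nat \<Rightarrow> nat) \<Rightarrow> nat \<Rightarrow> nat \<Rightarrow> complex mat set" where
  "C_rec d m l = {y. \<exists>X Z.
     (\<forall>k\<in>{1..m}. X k \<in> herm (d k) \<and> Z k \<in> herm (prefix_dim d k)) \<and>
     Z m = y \<and> Z 1 = X 1 \<and>
     (\<forall>k\<in>{1..m}. psd (X k) \<and> mat_trace (X k) = 1) \<and>
     (\<forall>k\<in>{2..m}. mat_trace (Z k) = 1 \<and>
        Z k \<in> DPS l (prefix_dim d (k - 1)) (d k) \<and>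
        ptrace_snd (prefix_dim d (k - 1)) (d k) (Z k) = Z (k - 1) \<and>
        ptrace_fst (prefix_dim d (k - 1)) (d k) (Z k) = X k)}"

datatype dtree = Leaf nat | Node dtree dtree

primrec leaves :: "dtree \<Rightarrow> nat list" where
  "leaves (Leaf k) = [k]"
| "leaves (Node A B) = leaves A @ leaves B"

text \<open>A node of a tree is represented by the subtree rooted at it. In a tree with distinct
  leaves, distinct nodes have distinct subtrees, so this loses nothing.\<close>

primrec nodes :: "dtree \<Rightarrow> dtree set" where
  "nodes (Leaf k) = {Leaf k}"
| "nodes (Node A B) = insert (Node A B) (nodes A \<union> nodes B)"

primrec node_dim :: "(nat \<Rightarrow> nat) \<Rightarrow> dtree \<Rightarrow> nat" where
  "node_dim d (Leaf k) = d k"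
| "node_dim d (Node A B) = node_dim d A * node_dim d B"

definition C_tree :: "(nat \<Rightarrow> nat) \<Rightarrow> dtree \<Rightarrow> nat \<Rightarrow> complex mat set" where
  "C_tree d T l = {y. \<exists>(X :: nat \<Rightarrow> complex mat) (Z :: dtree \<Rightarrow> complex mat).
     (\<forall>t\<in>nodes T. Z t \<in> herm (node_dim d t)) \<and>
     (\<forall>k\<in>set (leaves T). X k \<in> herm (d k)) \<and>
     Z T = y \<and>
     (\<forall>k\<in>set (leaves T). Z (Leaf k) = X k) \<and>
     (\<forall>t\<in>nodes T. psd (Z t) \<and> mat_trace (Z t) = 1) \<and>
     (\<forall>A B. Node A B \<in> nodes T \<longrightarrow>
        Z (Node A B) \<in> DPS l (node_dim d A) (node_dim d B) \<and>
        ptrace_fst (node_dim d A) (node_dim d B) (Z (Node A B)) = Z B \<and>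
        ptrace_snd (node_dim d A) (node_dim d B) (Z (Node A B)) = Z A)}"

end

theory Submission
  imports Defs
begin

text \<open>
  Both systems are convex because each of their constraints is: Hermiticity, positive
  semidefiniteness, the trace condition and the marginal conditions are linear or convex, and a convex
  combination of two DPS extensions is a DPS extension of the convex combination, the
  compression by \<open>Id \<otimes> \<Pi>\<close> and the partial transposes being linear maps.

  It remains to find a solution for each separable state. A separable state is a convex
  combination of pure product states \<open>u\<^sub>1 u\<^sub>1\<^sup>\<dagger> \<otimes> \<dots> \<otimes> u\<^sub>m u\<^sub>m\<^sup>\<dagger>\<close> with unit vectors
  \<open>u\<^sub>k\<close> (lemma \<open>Sep_subset_convex\<close>), so by convexity it suffices to treat these. For such a state
  assign to every node the projector onto the tensor product of the vectors of the leaves below it;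
  in the recursive system, the projector onto \<open>u\<^sub>1 \<otimes> \<dots> \<otimes> u\<^sub>k\<close> is assigned to \<open>Z\<^sub>k\<close>. The
  marginals are then correct because all vectors are unit vectors (\<open>product_in_C_rec\<close>,
  \<open>product_in_C_tree\<close>).

  The DPS condition at a node asks for an extension of the projector onto \<open>x \<otimes> y\<close>. The projector
  onto \<open>x \<otimes> y \<otimes> \<dots> \<otimes> y\<close> is one (\<open>product_in_DPS\<close>). It is invariant under compression since
  the power of \<open>y\<close> is a symmetric tensor, and a partial transpose merely replaces
  \<open>y\<close> by its complex conjugate at the transposed copies, which leaves a projector onto a product
  vector and hence a positive semidefinite matrix (\<open>ptranspose_outer_tensor_power\<close>).

  The projector \<open>\<Pi>\<close> is given by a definite description, so the argument also
  needs that the orthogonal projector onto the symmetric subspace exists and is unique; it is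
  the average of the permutation operators (\<open>is_orth_projector_sym_projector\<close>).
\<close>

section \<open>Digits\<close>

lemma undigits_0 [simp]: "undigits b 0 f = 0"
  by (simp add: undigits_def)

lemma undigits_Suc: "undigits b (Suc n) f = undigits b n f * b + f (Suc n)"
proof -
  have "(\<Sum>s=1..n. f s * b ^ (Suc n - s)) = (\<Sum>s=1..n. f s * b ^ (n - s) * b)"
    by (intro sum.cong refl) (auto simp: Suc_diff_le)
  then show ?thesis by (simp add: undigits_def sum_distrib_right)
qed

lemma digit_Suc: "s \<le> n \<Longrightarrow> digit b (Suc n) i s = digit b n (i div b) s"
  by (simp add: digit_def Suc_diff_le div_mult2_eq)

lemma digit_last: "digit b n i n = i mod b"
  by (simp add: digit_def)

lemma digit_less: "0 < b \<Longrightarrow> digit b n i s < b"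
  by (simp add: digit_def)

lemma undigits_cong: "(\<And>s. s \<in> {1..n} \<Longrightarrow> f s = g s) \<Longrightarrow> undigits b n f = undigits b n g"
  by (auto simp: undigits_def intro!: sum.cong)

lemma undigits_less:
  assumes "\<And>s. s \<in> {1..n} \<Longrightarrow> f s < b"
  shows "undigits b n f < b ^ n"
  using assms
proof (induction n)
  case (Suc n)
  have "undigits b n f + 1 \<le> b ^ n" using Suc by auto
  then have "(undigits b n f + 1) * b \<le> b ^ n * b" by (rule mult_le_mono1)
  moreover have "f (Suc n) < b" using Suc.prems by simp
  ultimately show ?case by (simp add: undigits_Suc algebra_simps)
qed simp

text \<open>Together with \<open>undigits_digit\<close> this identifies the indices below \<open>b ^ n\<close> with the
  \<open>n\<close>-tuples of digits, so that operations on tensor factors become operations on tuples.\<close>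

lemma digit_undigits:
  assumes "\<And>s. s \<in> {1..n} \<Longrightarrow> f s < b" "s \<in> {1..n}"
  shows "digit b n (undigits b n f) s = f s"
  using assms
proof (induction n)
  case (Suc n)
  have b: "f (Suc n) < b" using Suc.prems by simp
  show ?case
  proof (cases "s = Suc n")
    case True
    then show ?thesis using b by (simp add: digit_last undigits_Suc)
  next
    case False
    moreover have "(undigits b n f * b + f (Suc n)) div b = undigits b n f"
      using b by simp
    ultimately have "digit b (Suc n) (undigits b (Suc n) f) s = digit b n (undigits b n f) s"
      using Suc.prems by (simp add: digit_Suc undigits_Suc)
    then show ?thesis using Suc False by simp
  qed
qed simp

lemma undigits_digit: "i < b ^ n \<Longrightarrow> undigits b n (digit b n i) = i"
proof (induction n arbitrary: i)
  case (Suc n)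
  have "undigits b n (digit b (Suc n) i) = undigits b n (digit b n (i div b))"
    by (rule undigits_cong) (simp add: digit_Suc)
  also have "\<dots> = i div b"
    using Suc.prems by (intro Suc.IH) (metis less_mult_imp_div_less power_Suc2)
  finally show ?case by (simp add: undigits_Suc digit_last)
qed simp

text \<open>An index of \<open>\<complex>\<^sup>a \<otimes> (\<complex>\<^sup>b)\<^sup>\<otimes>\<^sup>n\<close> carries its \<open>\<complex>\<^sup>a\<close>-component in the part \<open>i div b ^ n\<close>,
  on which the digits of the tensor power do not depend.\<close>

lemma digit_mod: "s \<in> {1..n} \<Longrightarrow> digit b n (i mod b ^ n) s = digit b n i s"
proof (induction n arbitrary: i)
  case (Suc n)
  show ?case
  proof (cases "s = Suc n")
    case True
    then show ?thesis by (simp add: digit_last mod_mod_cancel)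
  next
    case False
    have "i mod b ^ Suc n div b = i div b mod b ^ n"
      by (cases "b = 0") (auto simp: mod_mult2_eq)
    then show ?thesis using Suc False by (simp add: digit_Suc)
  qed
qed simp


section \<open>The projector onto the symmetric subspace\<close>

text \<open>The index map underlying \<open>permute_factors\<close>. Isolating it turns statements on permuted tensors into
  reindexings of sums.\<close>

definition permute_digits :: "nat \<Rightarrow> nat \<Rightarrow> (nat \<Rightarrow> nat) \<Rightarrow> nat \<Rightarrow> nat" where
  "permute_digits b n \<sigma> i = undigits b n (\<lambda>s. digit b n i (\<sigma> s))"

lemma digit_less_base: "i < b ^ n \<Longrightarrow> s \<in> {1..n} \<Longrightarrow> digit b n i s' < b"
  by (rule digit_less) (auto intro: Nat.gr0I simp: power_0_left)

lemma permute_digits_less: "i < b ^ n \<Longrightarrow> permute_digits b n \<sigma> i < b ^ n"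
  unfolding permute_digits_def by (rule undigits_less) (rule digit_less_base)

text \<open>The order of the composition is reversed because the permutations act on positions, from the
  right.\<close>

lemma permute_digits_permute_digits:
  assumes "\<tau> permutes {1..n}" "i < b ^ n"
  shows "permute_digits b n \<tau> (permute_digits b n \<sigma> i) = permute_digits b n (\<sigma> \<circ> \<tau>) i"
  unfolding permute_digits_def
proof (rule undigits_cong, goal_cases)
  case (1 s)
  then have "\<tau> s \<in> {1..n}" using assms by (simp only: permutes_in_image)
  then show ?case
    using digit_undigits[of n "\<lambda>s. digit b n i (\<sigma> s)" b "\<tau> s"] digit_less_base[OF assms(2)]
    by auto
qed

lemma permute_digits_id: "i < b ^ n \<Longrightarrow> permute_digits b n id i = i"
  using undigits_digit by (simp add: permute_digits_def)

lemma bij_permute_digits: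
  assumes "\<sigma> permutes {1..n}"
  shows "bij_betw (permute_digits b n \<sigma>) {..<b ^ n} {..<b ^ n}"
proof (rule bij_betw_byWitness[where f' = "permute_digits b n (inv_into UNIV \<sigma>)"])
  note inverse = permutes_inv[OF assms] permutes_inv_o[OF assms]
  show "\<forall>i\<in>{..<b ^ n}. permute_digits b n (inv_into UNIV \<sigma>) (permute_digits b n \<sigma> i) = i"
    using inverse by (simp add: permute_digits_permute_digits permute_digits_id)
  show "\<forall>i\<in>{..<b ^ n}. permute_digits b n \<sigma> (permute_digits b n (inv_into UNIV \<sigma>) i) = i"
    using assms inverse by (simp add: permute_digits_permute_digits permute_digits_id)
qed (auto simp: permute_digits_less)

lemma permute_factors_index:
  "i < b ^ n \<Longrightarrow> permute_factors b n \<sigma> v $ i = v $ permute_digits b n \<sigma> i"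
  by (simp add: permute_factors_def permute_digits_def)

lemma cscalar_prod_sum:
  "v \<in> carrier_vec n \<Longrightarrow> u \<in> carrier_vec n \<Longrightarrow> v \<bullet>c u = (\<Sum>i<n. v $ i * cnj (u $ i))"
  by (auto simp: scalar_prod_def lessThan_atLeast0 conjugate_complex_def intro!: sum.cong)

lemma mult_mat_vec_sum:
  "A \<in> carrier_mat n m \<Longrightarrow> v \<in> carrier_vec m \<Longrightarrow> i < n \<Longrightarrow>
     (A *\<^sub>v v) $ i = (\<Sum>j<m. A $$ (i, j) * v $ j)"
  by (auto simp: scalar_prod_def lessThan_atLeast0 intro!: sum.cong)

definition symmetrizer :: "nat \<Rightarrow> nat \<Rightarrow> complex mat" where
  "symmetrizer b n = mat (b ^ n) (b ^ n) (\<lambda>(i, j).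
     (\<Sum>\<sigma> | \<sigma> permutes {1..n}. if permute_digits b n \<sigma> i = j then 1 else 0) / of_nat (fact n))"

lemma symmetrizer_carrier: "symmetrizer b n \<in> carrier_mat (b ^ n) (b ^ n)"
  by (simp add: symmetrizer_def)

lemma symmetrizer_mult_vec:
  assumes v: "v \<in> carrier_vec (b ^ n)" and i: "i < b ^ n"
  shows "(symmetrizer b n *\<^sub>v v) $ i =
    (\<Sum>\<sigma> | \<sigma> permutes {1..n}. v $ permute_digits b n \<sigma> i) / of_nat (fact n)"
proof -
  have "(symmetrizer b n *\<^sub>v v) $ i = (\<Sum>j<b ^ n. symmetrizer b n $$ (i, j) * v $ j)"
    by (rule mult_mat_vec_sum[OF symmetrizer_carrier v i])
  also have "\<dots> = (\<Sum>j<b ^ n. \<Sum>\<sigma> | \<sigma> permutes {1..n}.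
      (if permute_digits b n \<sigma> i = j then v $ j else 0) / of_nat (fact n))"
    using i by (auto simp: symmetrizer_def sum_distrib_right sum_divide_distrib intro!: sum.cong)
  also have "\<dots> = (\<Sum>\<sigma> | \<sigma> permutes {1..n}. \<Sum>j<b ^ n.
      (if permute_digits b n \<sigma> i = j then v $ j else 0) / of_nat (fact n))"
    by (rule sum.swap)
  also have "\<dots> = (\<Sum>\<sigma> | \<sigma> permutes {1..n}. v $ permute_digits b n \<sigma> i) / of_nat (fact n)"
    using permute_digits_less[OF i] by (simp add: sum_divide_distrib[symmetric])
  finally show ?thesis .
qed

text \<open>Applying a further permutation \<open>\<tau>\<close> only permutes the summands of the average.\<close>

lemma symmetrizer_in_sym_subspace:
  assumes v: "v \<in> carrier_vec (b ^ n)"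
  shows "symmetrizer b n *\<^sub>v v \<in> sym_subspace b n"
  unfolding sym_subspace_def
proof (safe)
  show car: "symmetrizer b n *\<^sub>v v \<in> carrier_vec (b ^ n)"
    by (rule mult_mat_vec_carrier[OF symmetrizer_carrier v])
  fix \<tau> assume \<tau>: "\<tau> permutes {1..n}"
  show "permute_factors b n \<tau> (symmetrizer b n *\<^sub>v v) = symmetrizer b n *\<^sub>v v"
  proof (rule eq_vecI)
    fix i assume "i < dim_vec (symmetrizer b n *\<^sub>v v)"
    then have i: "i < b ^ n" by (simp add: symmetrizer_def)
    have "permute_factors b n \<tau> (symmetrizer b n *\<^sub>v v) $ i
        = (\<Sum>\<sigma> | \<sigma> permutes {1..n}. v $ permute_digits b n \<sigma> (permute_digits b n \<tau> i)) / of_nat (fact n)"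
      using i by (simp add: permute_factors_index symmetrizer_mult_vec[OF v] permute_digits_less)
    also have "(\<Sum>\<sigma> | \<sigma> permutes {1..n}. v $ permute_digits b n \<sigma> (permute_digits b n \<tau> i))
        = (\<Sum>\<sigma> | \<sigma> permutes {1..n}. v $ permute_digits b n (\<tau> \<circ> \<sigma>) i)"
      using i by (auto intro!: sum.cong simp: permute_digits_permute_digits)
    also have "\<dots> = (\<Sum>\<sigma> | \<sigma> permutes {1..n}. v $ permute_digits b n \<sigma> i)"
      by (rule setum_permutations_compose_left[OF \<tau>, symmetric])
    finally show "permute_factors b n \<tau> (symmetrizer b n *\<^sub>v v) $ i = (symmetrizer b n *\<^sub>v v) $ i"
      using i by (simp add: symmetrizer_mult_vec[OF v])
  qed (simp add: permute_factors_def symmetrizer_def)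
qed

text \<open>Against a symmetric \<open>u\<close> each permuted copy of \<open>v\<close> has the same inner product as \<open>v\<close>
  itself, since \<open>u\<close> can be permuted along and the permutation then acts on the summation index of
  the inner product.\<close>

lemma symmetrizer_orthogonal:
  assumes v: "v \<in> carrier_vec (b ^ n)" and u: "u \<in> sym_subspace b n"
  shows "(v - symmetrizer b n *\<^sub>v v) \<bullet>c u = 0"
proof -
  have uc: "u \<in> carrier_vec (b ^ n)" using u by (simp add: sym_subspace_def)
  have inv: "u $ permute_digits b n \<sigma> i = u $ i" if "\<sigma> permutes {1..n}" "i < b ^ n" for \<sigma> i
    using u that permute_factors_index[of i b n \<sigma> u] by (auto simp: sym_subspace_def)
  have "(symmetrizer b n *\<^sub>v v) \<bullet>c u = (\<Sum>i<b ^ n. (symmetrizer b n *\<^sub>v v) $ i * cnj (u $ i))"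
    by (rule cscalar_prod_sum[OF mult_mat_vec_carrier[OF symmetrizer_carrier v] uc])
  also have "\<dots> = (\<Sum>i<b ^ n. \<Sum>\<sigma> | \<sigma> permutes {1..n}.
      v $ permute_digits b n \<sigma> i * cnj (u $ permute_digits b n \<sigma> i) / of_nat (fact n))"
    by (auto intro!: sum.cong
        simp: symmetrizer_mult_vec[OF v] sum_divide_distrib sum_distrib_right inv)
  also have "\<dots> = (\<Sum>\<sigma> | \<sigma> permutes {1..n}. (\<Sum>i<b ^ n.
      v $ permute_digits b n \<sigma> i * cnj (u $ permute_digits b n \<sigma> i)) / of_nat (fact n))"
    by (subst sum.swap) (simp add: sum_divide_distrib)
  also have "\<dots> = (\<Sum>\<sigma> | \<sigma> permutes {1..n}. (\<Sum>i<b ^ n. v $ i * cnj (u $ i)) / of_nat (fact n))"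
    by (intro sum.cong refl arg_cong2[where f = "(/)"]
        sum.reindex_bij_betw[OF bij_permute_digits, where g = "\<lambda>i. v $ i * cnj (u $ i)"]) auto
  also have "\<dots> = v \<bullet>c u"
    using cscalar_prod_sum[OF v uc] card_permutations[of "{1..n}" n] by simp
  finally show ?thesis
    using v uc mult_mat_vec_carrier[OF symmetrizer_carrier v]
    by (subst minus_scalar_prod_distrib[of _ "b ^ n"]) auto
qed

lemma eq_if_cscalar_prod_diff_eq_0:
  fixes p q :: "complex vec"
  assumes "p \<in> carrier_vec n" "q \<in> carrier_vec n" "(p - q) \<bullet>c (p - q) = 0"
  shows "p = q"
proof -
  have "p - q = 0\<^sub>v n"
    using assms conjugate_square_eq_0_vec[of "p - q" n] by auto
  then show ?thesis
    using assms(1,2) by (auto simp: vec_eq_iff)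
qed

lemma sym_subspace_diff:
  assumes "p \<in> sym_subspace b n" "q \<in> sym_subspace b n"
  shows "p - q \<in> sym_subspace b n"
proof -
  have "permute_factors b n \<sigma> (p - q) = p - q" if s: "\<sigma> permutes {1..n}" for \<sigma>
  proof (rule eq_vecI)
    fix i assume "i < dim_vec (p - q)"
    then have i: "i < b ^ n" using assms by (auto simp: sym_subspace_def)
    have "r $ permute_digits b n \<sigma> i = r $ i" if "r \<in> sym_subspace b n" for r
      using that s i permute_factors_index[of i b n \<sigma> r] by (auto simp: sym_subspace_def)
    then show "permute_factors b n \<sigma> (p - q) $ i = (p - q) $ i"
      using assms i by (auto simp: permute_factors_index permute_digits_less sym_subspace_def)
  qed (use assms in \<open>auto simp: permute_factors_def sym_subspace_def\<close>)
  then show ?thesis using assms by (auto simp: sym_subspace_def)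
qed

text \<open>If \<open>w\<close> also satisfies the defining property of the projection of \<open>v\<close>, then \<open>P v - w\<close> lies in the
  subspace and is orthogonal to it.\<close>

lemma orth_projector_eqI:
  assumes P: "is_orth_projector (b ^ n) (sym_subspace b n) P"
    and v: "v \<in> carrier_vec (b ^ n)" and w: "w \<in> sym_subspace b n"
    and orth: "\<And>u. u \<in> sym_subspace b n \<Longrightarrow> (v - w) \<bullet>c u = 0"
  shows "P *\<^sub>v v = w"
proof -
  have Pv: "P *\<^sub>v v \<in> sym_subspace b n" using P v by (auto simp: is_orth_projector_def)
  have c: "P *\<^sub>v v \<in> carrier_vec (b ^ n)" "w \<in> carrier_vec (b ^ n)"
    using Pv w by (auto simp: sym_subspace_def)
  define u where "u = P *\<^sub>v v - w"
  have u: "u \<in> sym_subspace b n" using sym_subspace_diff[OF Pv w] by (simp add: u_def)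
  have "(v - P *\<^sub>v v) \<bullet>c u = 0" using P v u by (auto simp: is_orth_projector_def)
  moreover have "(v - w) \<bullet>c u = 0" using orth u .
  moreover have "u \<in> carrier_vec (b ^ n)" using c by (simp add: u_def)
  ultimately have "u \<bullet>c u = 0"
    using v c by (simp add: minus_scalar_prod_distrib[of _ "b ^ n"] u_def)
  then show ?thesis using eq_if_cscalar_prod_diff_eq_0[OF c] by (simp add: u_def)
qed

lemma is_orth_projector_sym_projector:
  "is_orth_projector (b ^ n) (sym_subspace b n) (sym_projector b n)"
proof -
  have ex: "is_orth_projector (b ^ n) (sym_subspace b n) (symmetrizer b n)"
    by (simp add: is_orth_projector_def symmetrizer_carrier symmetrizer_in_sym_subspace
        symmetrizer_orthogonal)
  have "P = symmetrizer b n" if P: "is_orth_projector (b ^ n) (sym_subspace b n) P" for P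
  proof (rule eq_matI)
    fix i j assume "i < dim_row (symmetrizer b n)" "j < dim_col (symmetrizer b n)"
    then have ij: "i < b ^ n" "j < b ^ n" by (auto simp: symmetrizer_def)
    have "P *\<^sub>v unit_vec (b ^ n) j = symmetrizer b n *\<^sub>v unit_vec (b ^ n) j"
      by (rule orth_projector_eqI[OF P])
        (auto simp: symmetrizer_in_sym_subspace symmetrizer_orthogonal)
    moreover have "(A *\<^sub>v unit_vec (b ^ n) j) $ i = A $$ (i, j)"
      if "A \<in> carrier_mat (b ^ n) (b ^ n)" for A :: "complex mat"
      using that ij by simp
    ultimately show "P $$ (i, j) = symmetrizer b n $$ (i, j)"
      using P symmetrizer_carrier[of b n] by (metis is_orth_projector_def)
  qed (use P in \<open>auto simp: is_orth_projector_def symmetrizer_def\<close>)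
  with ex show ?thesis unfolding sym_projector_def by (rule theI)
qed

lemma sym_projector_carrier: "sym_projector b n \<in> carrier_mat (b ^ n) (b ^ n)"
  using is_orth_projector_sym_projector by (auto simp: is_orth_projector_def)

lemma sym_projector_fixes:
  assumes z: "z \<in> sym_subspace b n"
  shows "sym_projector b n *\<^sub>v z = z"
  using is_orth_projector_sym_projector _ z
proof (rule orth_projector_eqI)
  show "(z - z) \<bullet>c u = 0" if "u \<in> sym_subspace b n" for u
    using that z by (auto simp: sym_subspace_def cscalar_prod_sum[of _ "b ^ n"])
qed (use z in \<open>auto simp: sym_subspace_def\<close>)

section \<open>Hermitian and positive semidefinite matrices\<close>

text \<open>An entrywise form of Hermiticity, in which closure properties are direct computations.\<close>

lemma herm_iff:
  "A \<in> herm n \<longleftrightarrow> A \<in> carrier_mat n n \<and> (\<forall>i<n. \<forall>j<n. A $$ (i, j) = cnj (A $$ (j, i)))"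
proof (cases "A \<in> carrier_mat n n")
  case True
  have "mat_adjoint A = A \<longleftrightarrow> (\<forall>i<n. \<forall>j<n. mat_adjoint A $$ (i, j) = A $$ (i, j))"
    using True by (simp add: mat_eq_iff mat_adjoint_def)
  moreover have "mat_adjoint A $$ (i, j) = cnj (A $$ (j, i))" if "i < n" "j < n" for i j
    using True that by (simp add: mat_adjoint_def mat_of_rows_def)
  ultimately show ?thesis
    using True by (simp add: herm_def) metis
qed (simp add: herm_def)

lemma herm_carrier: "A \<in> herm n \<Longrightarrow> A \<in> carrier_mat n n"
  by (simp add: herm_def)

lemma psd_iff:
  assumes "A \<in> carrier_mat n n"
  shows "psd A \<longleftrightarrow> A \<in> herm n \<and>
    (\<forall>v \<in> carrier_vec n. 0 \<le> Re (\<Sum>i<n. \<Sum>j<n. A $$ (i, j) * v $ j * cnj (v $ i)))"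
proof -
  have "(A *\<^sub>v v) \<bullet>c v = (\<Sum>i<n. \<Sum>j<n. A $$ (i, j) * v $ j * cnj (v $ i))"
    if v: "v \<in> carrier_vec n" for v
  proof -
    have "(A *\<^sub>v v) \<bullet>c v = (\<Sum>i<n. (A *\<^sub>v v) $ i * cnj (v $ i))"
      by (rule cscalar_prod_sum[OF mult_mat_vec_carrier[OF assms v] v])
    then show ?thesis
      by (simp add: mult_mat_vec_sum[OF assms v] sum_distrib_right)
  qed
  then have "(\<forall>v \<in> carrier_vec n. 0 \<le> Re ((A *\<^sub>v v) \<bullet>c v)) \<longleftrightarrow>
    (\<forall>v \<in> carrier_vec n. 0 \<le> Re (\<Sum>i<n. \<Sum>j<n. A $$ (i, j) * v $ j * cnj (v $ i)))"
    by (intro ball_cong refl) (simp only:)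
  moreover have "dim_row A = n" using assms by simp
  ultimately show ?thesis by (simp only: psd_def)
qed

lemma outer_carrier: "x \<in> carrier_vec n \<Longrightarrow> outer x \<in> carrier_mat n n"
  by (auto simp: outer_def)

lemma outer_herm: "x \<in> carrier_vec n \<Longrightarrow> outer x \<in> herm n"
  by (auto simp: herm_iff outer_def)

text \<open>The quadratic form of \<open>x x\<^sup>\<dagger>\<close> at \<open>v\<close> is the squared modulus of an inner product.\<close>

lemma psd_outer: "psd (outer x)"
proof -
  define n where "n = dim_vec x"
  have x: "x \<in> carrier_vec n" unfolding n_def by (rule carrier_vecI) (rule refl)
  have "0 \<le> Re (\<Sum>i<n. \<Sum>j<n. outer x $$ (i, j) * v $ j * cnj (v $ i))"
    if v: "v \<in> carrier_vec n" for v
  proof -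
    define c where "c = (\<Sum>i<n. x $ i * cnj (v $ i))"
    have "(\<Sum>i<n. \<Sum>j<n. outer x $$ (i, j) * v $ j * cnj (v $ i))
        = (\<Sum>i<n. \<Sum>j<n. (x $ i * cnj (v $ i)) * cnj (x $ j * cnj (v $ j)))"
      by (intro sum.cong refl) (auto simp add: outer_def n_def)
    also have "\<dots> = c * cnj c"
      by (simp only: c_def cnj_sum sum_product)
    finally show ?thesis by (simp add: complex_mult_cnj)
  qed
  then show ?thesis using psd_iff[OF outer_carrier[OF x]] outer_herm[OF x] by simp
qed

text \<open>The trace of \<open>x x\<^sup>\<dagger>\<close> is the squared norm of \<open>x\<close>; throughout, \<open>mat_trace (outer x) = 1\<close>
  says that \<open>x\<close> is a unit vector.\<close>

lemma mat_trace_outer: "mat_trace (outer x) = complex_of_real (\<Sum>i<dim_vec x. (cmod (x $ i))\<^sup>2)"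
  by (simp add: mat_trace_def outer_def complex_norm_square[symmetric])

lemma mat_trace_outer_eq_0:
  assumes "mat_trace (outer x) = 0"
  shows "outer x = 0\<^sub>m (dim_vec x) (dim_vec x)"
proof -
  have "(\<Sum>i<dim_vec x. (cmod (x $ i))\<^sup>2) = 0"
    using assms unfolding mat_trace_outer by (simp only: of_real_eq_0_iff)
  then have "x $ i = 0" if "i < dim_vec x" for i
    using that by (simp add: sum_nonneg_eq_0_iff)
  then show ?thesis by (auto simp: outer_def)
qed

lemma outer_smult: "outer (c \<cdot>\<^sub>v x) = (c * cnj c) \<cdot>\<^sub>m outer x"
  by (auto simp: outer_def)

lemma mat_trace_smult: "mat_trace (c \<cdot>\<^sub>m A) = c * mat_trace A" if "A \<in> carrier_mat n n" for c :: complex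
  using that by (auto simp: mat_trace_def sum_distrib_left)


section \<open>Convexity\<close>

definition mix :: "real \<Rightarrow> complex mat \<Rightarrow> complex mat \<Rightarrow> complex mat" where
  "mix t A B = complex_of_real (1 - t) \<cdot>\<^sub>m A + complex_of_real t \<cdot>\<^sub>m B"

lemma mix_carrier: "A \<in> carrier_mat n k \<Longrightarrow> B \<in> carrier_mat n k \<Longrightarrow> mix t A B \<in> carrier_mat n k"
  by (simp add: mix_def)

lemma mix_index:
  "\<lbrakk>A \<in> carrier_mat n k; B \<in> carrier_mat n k; i < n; j < k\<rbrakk> \<Longrightarrow>
    mix t A B $$ (i, j) = complex_of_real (1 - t) * A $$ (i, j) + complex_of_real t * B $$ (i, j)"
  by (simp add: mix_def)

lemma mat_convex_iff:
  "mat_convex C \<longleftrightarrow> (\<forall>A\<in>C. \<forall>B\<in>C. \<forall>t. 0 \<le> t \<and> t \<le> 1 \<longrightarrow> mix t A B \<in> C)"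
  by (simp add: mat_convex_def mix_def)

lemma herm_mix: "A \<in> herm n \<Longrightarrow> B \<in> herm n \<Longrightarrow> mix t A B \<in> herm n"
  unfolding herm_iff
proof (intro conjI allI impI; elim conjE)
  fix i j assume ij: "i < n" "j < n"
    and c: "A \<in> carrier_mat n n" "B \<in> carrier_mat n n"
    and h: "\<forall>i<n. \<forall>j<n. A $$ (i, j) = cnj (A $$ (j, i))"
      "\<forall>i<n. \<forall>j<n. B $$ (i, j) = cnj (B $$ (j, i))"
  have "A $$ (i, j) = cnj (A $$ (j, i))" "B $$ (i, j) = cnj (B $$ (j, i))"
    using h ij by blast+
  then show "mix t A B $$ (i, j) = cnj (mix t A B $$ (j, i))"
    using ij c by (simp add: mix_index[of _ n n])
qed (simp add: mix_carrier)

lemma psd_mix: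
  assumes "psd A" "psd B" "A \<in> carrier_mat n n" "B \<in> carrier_mat n n" "0 \<le> t" "t \<le> 1"
  shows "psd (mix t A B)"
proof -
  have c: "mix t A B \<in> carrier_mat n n" using assms by (simp add: mix_carrier)
  have "0 \<le> Re (\<Sum>i<n. \<Sum>j<n. mix t A B $$ (i, j) * v $ j * cnj (v $ i))"
    if v: "v \<in> carrier_vec n" for v
  proof -
    let ?q = "\<lambda>A. \<Sum>i<n. \<Sum>j<n. A $$ (i, j) * v $ j * cnj (v $ i)"
    have "?q (mix t A B) = complex_of_real (1 - t) * ?q A + complex_of_real t * ?q B"
    proof -
      have "?q (mix t A B) = (\<Sum>i<n. \<Sum>j<n.
          complex_of_real (1 - t) * (A $$ (i, j) * v $ j * cnj (v $ i)) +
          complex_of_real t * (B $$ (i, j) * v $ j * cnj (v $ i)))"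
        using assms(3,4) by (intro sum.cong refl) (simp add: mix_index[of _ n n] algebra_simps)
      then show ?thesis
        by (simp only: sum.distrib sum_distrib_left)
    qed
    then have "Re (?q (mix t A B)) = (1 - t) * Re (?q A) + t * Re (?q B)"
      by (simp only: plus_complex.sel times_complex.sel Re_complex_of_real Im_complex_of_real
          mult_zero_left diff_zero)
    moreover have "0 \<le> Re (?q A)" "0 \<le> Re (?q B)"
      using assms(1,2) v psd_iff[OF assms(3)] psd_iff[OF assms(4)] by blast+
    ultimately show ?thesis using assms(5,6) by simp
  qed
  then show ?thesis
    using psd_iff[OF c] assms(1,2) herm_mix psd_iff[OF assms(3)] psd_iff[OF assms(4)] by blast
qed

lemma mat_trace_mix:
  assumes "A \<in> carrier_mat n n" "B \<in> carrier_mat n n"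
  shows "mat_trace (mix t A B) = complex_of_real (1 - t) * mat_trace A + complex_of_real t * mat_trace B"
  using assms by (simp add: mix_def mat_trace_def sum.distrib sum_distrib_left)

lemma mult_add_less_mult: "k < a \<Longrightarrow> i < b \<Longrightarrow> k * b + i < a * (b::nat)"
proof -
  assume "k < a" "i < b"
  then have "k * b + i < Suc k * b" "Suc k * b \<le> a * b"
    by (simp_all only: mult_le_mono1 Suc_le_eq) simp
  then show ?thesis by linarith
qed

lemma ptrace_fst_mix:
  assumes "A \<in> carrier_mat (a * b) (a * b)" "B \<in> carrier_mat (a * b) (a * b)"
  shows "ptrace_fst a b (mix t A B) = mix t (ptrace_fst a b A) (ptrace_fst a b B)"
  using assms by (intro eq_matI)
    (simp_all add: mix_def ptrace_fst_def mult_add_less_mult sum.distrib sum_distrib_left)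

lemma ptrace_snd_mix:
  assumes "A \<in> carrier_mat (a * b) (a * b)" "B \<in> carrier_mat (a * b) (a * b)"
  shows "ptrace_snd a b (mix t A B) = mix t (ptrace_snd a b A) (ptrace_snd a b B)"
  using assms by (intro eq_matI)
    (simp_all add: mix_def ptrace_snd_def mult_add_less_mult sum.distrib sum_distrib_left)

lemma mix_digits_less:
  assumes "i < a * b ^ n" "j < a * b ^ n"
  shows "mix_digits b n I i j < a * b ^ n"
proof -
  have b: "digit b n k s < b" if "s \<in> {1..n}" for k s
    using that assms by (intro digit_less) (auto intro: Nat.gr0I simp: power_0_left)
  have "undigits b n (\<lambda>s. if s \<in> I then digit b n j s else digit b n i s) < b ^ n"
    using b by (intro undigits_less) auto
  moreover have "i div b ^ n < a" using assms by (simp add: less_mult_imp_div_less)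
  ultimately show ?thesis by (simp add: mix_digits_def mult_add_less_mult)
qed

lemma ptranspose_mix:
  assumes "A \<in> carrier_mat (a * b ^ n) (a * b ^ n)" "B \<in> carrier_mat (a * b ^ n) (a * b ^ n)"
  shows "ptranspose a b n I (mix t A B) = mix t (ptranspose a b n I A) (ptranspose a b n I B)"
  using assms by (intro eq_matI) (simp_all add: mix_def ptranspose_def mix_digits_less)

lemma mult_mix_mult:
  assumes "P \<in> carrier_mat n n" "A \<in> carrier_mat n n" "B \<in> carrier_mat n n" "Q \<in> carrier_mat n n"
  shows "P * mix t A B * Q = mix t (P * A * Q) (P * B * Q)"
proof -
  have eq: "P * mix t A B = complex_of_real (1 - t) \<cdot>\<^sub>m (P * A) + complex_of_real t \<cdot>\<^sub>m (P * B)"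
    using assms by (simp add: mix_def mult_add_distrib_mat[of P n n _ n] mult_smult_distrib[of P n n _ n])
  show ?thesis
    using assms unfolding eq by (simp add: mix_def add_mult_distrib_mat[of _ n n _ Q n] mult_smult_assoc_mat[of _ n n Q n])
qed

lemma density_mix:
  assumes "A \<in> density n" "B \<in> density n" "0 \<le> t" "t \<le> 1"
  shows "mix t A B \<in> density n"
  using assms herm_carrier psd_mix[of A B n t] herm_mix[of A n B t] mat_trace_mix[of A n B t]
  by (auto simp: density_def)

lemma kron_carrier:
  "A \<in> carrier_mat a a \<Longrightarrow> B \<in> carrier_mat b b \<Longrightarrow> kron A B \<in> carrier_mat (a * b) (a * b)"
  by (auto simp: kron_def)

text \<open>The same combination of the two extensions is an extension: the conditions that
  relate it to the state are linear, and the positivity conditions are convex.\<close>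

lemma DPS_mix:
  assumes A: "A \<in> DPS l a b" and B: "B \<in> DPS l a b" and t: "0 \<le> t" "t \<le> 1" and l: "1 \<le> l"
  shows "mix t A B \<in> DPS l a b"
proof -
  let ?P = "kron (1\<^sub>m a) (sym_projector b l)"
  have P: "?P \<in> carrier_mat (a * b ^ l) (a * b ^ l)"
    by (intro kron_carrier sym_projector_carrier) simp
  \<comment> \<open>The partial trace views the space with the first copy of \<open>B\<close> attached to \<open>A\<close>, which needs at least one copy.\<close>
  have dim: "a * b * b ^ (l - 1) = a * b ^ l"
    using l by (cases l) simp_all
  obtain \<rho> where \<rho>: "\<rho> \<in> herm (a * b ^ l)" "psd \<rho>" "ptrace_snd (a * b) (b ^ (l - 1)) \<rho> = A"
      "?P * \<rho> * ?P = \<rho>" "\<And>I. I \<subseteq> {1..l} \<and> I \<noteq> {} \<Longrightarrow> psd (ptranspose a b l I \<rho>)"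
    using A by (auto simp: DPS_def)
  obtain \<sigma> where \<sigma>: "\<sigma> \<in> herm (a * b ^ l)" "psd \<sigma>" "ptrace_snd (a * b) (b ^ (l - 1)) \<sigma> = B"
      "?P * \<sigma> * ?P = \<sigma>" "\<And>I. I \<subseteq> {1..l} \<and> I \<noteq> {} \<Longrightarrow> psd (ptranspose a b l I \<sigma>)"
    using B by (auto simp: DPS_def)
  note c = herm_carrier[OF \<rho>(1)] herm_carrier[OF \<sigma>(1)]
  have "psd (ptranspose a b l I (mix t \<rho> \<sigma>))" if I: "I \<subseteq> {1..l} \<and> I \<noteq> {}" for I
    unfolding ptranspose_mix[OF c]
    by (rule psd_mix[OF \<rho>(5)[OF I] \<sigma>(5)[OF I] _ _ t, of "a * b ^ l"]) (simp_all add: ptranspose_def)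
  moreover have "mix t A B \<in> density (a * b)"
    using A B density_mix[OF _ _ t] by (auto simp: DPS_def)
  moreover have "ptrace_snd (a * b) (b ^ (l - 1)) (mix t \<rho> \<sigma>) = mix t A B"
    using ptrace_snd_mix[of \<rho> "a * b" "b ^ (l - 1)" \<sigma> t, unfolded dim, OF c] \<rho>(3) \<sigma>(3) by simp
  moreover have "?P * mix t \<rho> \<sigma> * ?P = mix t \<rho> \<sigma>"
    using mult_mix_mult[OF P c P] \<rho>(4) \<sigma>(4) by simp
  ultimately show ?thesis
    using herm_mix[OF \<rho>(1) \<sigma>(1)] psd_mix[OF \<rho>(2) \<sigma>(2) c t] unfolding DPS_def by blast
qed

lemma prefix_dim_Suc: "prefix_dim d (Suc k) = prefix_dim d k * d (Suc k)"
  by (simp add: prefix_dim_def mult.commute)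

lemma mat_convex_C_rec:
  assumes "1 \<le> l"
  shows "mat_convex (C_rec d m l)"
  unfolding mat_convex_iff
proof (intro ballI allI impI)
  fix y y' and t :: real
  assume y: "y \<in> C_rec d m l" and y': "y' \<in> C_rec d m l" and t: "0 \<le> t \<and> t \<le> 1"
  from y obtain X Z where
    h: "\<forall>k\<in>{1..m}. X k \<in> herm (d k) \<and> Z k \<in> herm (prefix_dim d k)"
    and Z: "Z m = y" "Z 1 = X 1" and X: "\<forall>k\<in>{1..m}. psd (X k) \<and> mat_trace (X k) = 1"
    and K: "\<forall>k\<in>{2..m}. mat_trace (Z k) = 1 \<and> Z k \<in> DPS l (prefix_dim d (k - 1)) (d k) \<and>
        ptrace_snd (prefix_dim d (k - 1)) (d k) (Z k) = Z (k - 1) \<and>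
        ptrace_fst (prefix_dim d (k - 1)) (d k) (Z k) = X k"
    unfolding C_rec_def by blast
  from y' obtain X' Z' where
    h': "\<forall>k\<in>{1..m}. X' k \<in> herm (d k) \<and> Z' k \<in> herm (prefix_dim d k)"
    and Z': "Z' m = y'" "Z' 1 = X' 1" and X': "\<forall>k\<in>{1..m}. psd (X' k) \<and> mat_trace (X' k) = 1"
    and K': "\<forall>k\<in>{2..m}. mat_trace (Z' k) = 1 \<and> Z' k \<in> DPS l (prefix_dim d (k - 1)) (d k) \<and>
        ptrace_snd (prefix_dim d (k - 1)) (d k) (Z' k) = Z' (k - 1) \<and>
        ptrace_fst (prefix_dim d (k - 1)) (d k) (Z' k) = X' k"
    unfolding C_rec_def by blast
  let ?X = "\<lambda>k. mix t (X k) (X' k)" and ?Z = "\<lambda>k. mix t (Z k) (Z' k)"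
  have 1: "\<forall>k\<in>{1..m}. ?X k \<in> herm (d k) \<and> ?Z k \<in> herm (prefix_dim d k)"
    using h h' herm_mix by blast
  have 2: "\<forall>k\<in>{1..m}. psd (?X k) \<and> mat_trace (?X k) = 1"
  proof
    fix k assume k: "k \<in> {1..m}"
    have "X k \<in> carrier_mat (d k) (d k)" "X' k \<in> carrier_mat (d k) (d k)"
      using k h h' herm_carrier by blast+
    then show "psd (?X k) \<and> mat_trace (?X k) = 1"
      using psd_mix[of "X k" "X' k" "d k" t] mat_trace_mix[of "X k" "d k" "X' k" t] X X' k t by simp
  qed
  have 3: "\<forall>k\<in>{2..m}. mat_trace (?Z k) = 1 \<and> ?Z k \<in> DPS l (prefix_dim d (k - 1)) (d k) \<and>
      ptrace_snd (prefix_dim d (k - 1)) (d k) (?Z k) = ?Z (k - 1) \<and>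
      ptrace_fst (prefix_dim d (k - 1)) (d k) (?Z k) = ?X k"
  proof
    fix k assume k: "k \<in> {2..m}"
    have k1: "k \<in> {1..m}" using k by simp
    have "prefix_dim d k = prefix_dim d (k - 1) * d k"
      using k prefix_dim_Suc[of d "k - 1"] by simp
    then have c: "Z k \<in> carrier_mat (prefix_dim d (k - 1) * d k) (prefix_dim d (k - 1) * d k)"
      "Z' k \<in> carrier_mat (prefix_dim d (k - 1) * d k) (prefix_dim d (k - 1) * d k)"
      using h h' k1 herm_carrier by metis+
    then show "mat_trace (?Z k) = 1 \<and> ?Z k \<in> DPS l (prefix_dim d (k - 1)) (d k) \<and>
        ptrace_snd (prefix_dim d (k - 1)) (d k) (?Z k) = ?Z (k - 1) \<and>
        ptrace_fst (prefix_dim d (k - 1)) (d k) (?Z k) = ?X k"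
      using k K K' t assms DPS_mix[of "Z k" l _ _ "Z' k" t]
        mat_trace_mix[OF c] ptrace_fst_mix[OF c] ptrace_snd_mix[OF c] by simp
  qed
  have 4: "?Z m = mix t y y'" "?Z 1 = ?X 1" using Z Z' by simp_all
  show "mix t y y' \<in> C_rec d m l"
    unfolding C_rec_def mem_Collect_eq
    by (rule exI[of _ ?X], rule exI[of _ ?Z], intro conjI; fact)
qed

lemma mat_convex_C_tree:
  assumes "1 \<le> l"
  shows "mat_convex (C_tree d T l)"
  unfolding mat_convex_iff
proof (intro ballI allI impI)
  fix y y' and t :: real
  assume y: "y \<in> C_tree d T l" and y': "y' \<in> C_tree d T l" and t: "0 \<le> t \<and> t \<le> 1"
  from y obtain X Z where
    h: "\<forall>t\<in>nodes T. Z t \<in> herm (node_dim d t)" "\<forall>k\<in>set (leaves T). X k \<in> herm (d k)"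
    and Z: "Z T = y" "\<forall>k\<in>set (leaves T). Z (Leaf k) = X k"
    and X: "\<forall>t\<in>nodes T. psd (Z t) \<and> mat_trace (Z t) = 1"
    and K: "\<forall>A B. Node A B \<in> nodes T \<longrightarrow>
        Z (Node A B) \<in> DPS l (node_dim d A) (node_dim d B) \<and>
        ptrace_fst (node_dim d A) (node_dim d B) (Z (Node A B)) = Z B \<and>
        ptrace_snd (node_dim d A) (node_dim d B) (Z (Node A B)) = Z A"
    unfolding C_tree_def by blast
  from y' obtain X' Z' where
    h': "\<forall>t\<in>nodes T. Z' t \<in> herm (node_dim d t)" "\<forall>k\<in>set (leaves T). X' k \<in> herm (d k)"
    and Z': "Z' T = y'" "\<forall>k\<in>set (leaves T). Z' (Leaf k) = X' k"
    and X': "\<forall>t\<in>nodes T. psd (Z' t) \<and> mat_trace (Z' t) = 1"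
    and K': "\<forall>A B. Node A B \<in> nodes T \<longrightarrow>
        Z' (Node A B) \<in> DPS l (node_dim d A) (node_dim d B) \<and>
        ptrace_fst (node_dim d A) (node_dim d B) (Z' (Node A B)) = Z' B \<and>
        ptrace_snd (node_dim d A) (node_dim d B) (Z' (Node A B)) = Z' A"
    unfolding C_tree_def by blast
  let ?X = "\<lambda>k. mix t (X k) (X' k)" and ?Z = "\<lambda>k. mix t (Z k) (Z' k)"
  have 1: "\<forall>t\<in>nodes T. ?Z t \<in> herm (node_dim d t)" "\<forall>k\<in>set (leaves T). ?X k \<in> herm (d k)"
    using h h' herm_mix by blast+
  have 2: "\<forall>s\<in>nodes T. psd (?Z s) \<and> mat_trace (?Z s) = 1"
  proof
    fix s assume s: "s \<in> nodes T"
    have "Z s \<in> carrier_mat (node_dim d s) (node_dim d s)"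
      "Z' s \<in> carrier_mat (node_dim d s) (node_dim d s)"
      using s h h' herm_carrier by blast+
    then show "psd (?Z s) \<and> mat_trace (?Z s) = 1"
      using psd_mix[of "Z s" "Z' s" "node_dim d s" t] mat_trace_mix[of "Z s" "node_dim d s" "Z' s" t]
        X X' s t by simp
  qed
  have 3: "\<forall>A B. Node A B \<in> nodes T \<longrightarrow> ?Z (Node A B) \<in> DPS l (node_dim d A) (node_dim d B) \<and>
      ptrace_fst (node_dim d A) (node_dim d B) (?Z (Node A B)) = ?Z B \<and>
      ptrace_snd (node_dim d A) (node_dim d B) (?Z (Node A B)) = ?Z A"
  proof (intro allI impI)
    fix A B assume s: "Node A B \<in> nodes T"
    let ?n = "node_dim d A * node_dim d B"
    have c: "Z (Node A B) \<in> carrier_mat ?n ?n" "Z' (Node A B) \<in> carrier_mat ?n ?n"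
      using s h(1) h'(1) herm_carrier by (metis node_dim.simps(2))+
    then show "?Z (Node A B) \<in> DPS l (node_dim d A) (node_dim d B) \<and>
        ptrace_fst (node_dim d A) (node_dim d B) (?Z (Node A B)) = ?Z B \<and>
        ptrace_snd (node_dim d A) (node_dim d B) (?Z (Node A B)) = ?Z A"
      using s K K' t assms DPS_mix[of "Z (Node A B)" l _ _ "Z' (Node A B)" t]
        ptrace_fst_mix[OF c] ptrace_snd_mix[OF c] by simp
  qed
  have 4: "?Z T = mix t y y'" "\<forall>k\<in>set (leaves T). ?Z (Leaf k) = ?X k" using Z Z' by simp_all
  show "mix t y y' \<in> C_tree d T l"
    unfolding C_tree_def mem_Collect_eq
    by (rule exI[of _ ?X], rule exI[of _ ?Z], intro conjI; fact)
qed


section \<open>Tensor products of vectors\<close>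

definition vkron :: "complex vec \<Rightarrow> complex vec \<Rightarrow> complex vec" where
  "vkron x y = vec (dim_vec x * dim_vec y) (\<lambda>i. x $ (i div dim_vec y) * y $ (i mod dim_vec y))"

lemma dim_vkron [simp]: "dim_vec (vkron x y) = dim_vec x * dim_vec y"
  by (simp add: vkron_def)

lemma vkron_carrier: "x \<in> carrier_vec a \<Longrightarrow> y \<in> carrier_vec b \<Longrightarrow> vkron x y \<in> carrier_vec (a * b)"
  by (metis carrier_vecD carrier_vecI dim_vkron)

lemma div_mod_less:
  "i < a * b \<Longrightarrow> i div b < a \<and> i mod b < (b::nat)"
  by (cases "b = 0") (auto simp: less_mult_imp_div_less)

lemma vkron_index:
  "i < dim_vec x * dim_vec y \<Longrightarrow> vkron x y $ i = x $ (i div dim_vec y) * y $ (i mod dim_vec y)"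
  by (simp add: vkron_def)

lemma mod_mult_div_mod:
  "i mod (b * c) div c = i div c mod b \<and> i mod (b * c) mod c = i mod (c::nat)"
proof (cases "c = 0")
  case False
  have "i mod (b * c) = (i div c mod b) * c + i mod c"
    by (simp add: mult.commute[of b] mod_mult2_eq)
  moreover have "i mod c < c" using False by simp
  ultimately show ?thesis by simp
qed simp

lemma vkron_assoc: "vkron (vkron x y) z = vkron x (vkron y z)"
proof (rule eq_vecI)
  fix i assume "i < dim_vec (vkron x (vkron y z))"
  then have i: "i < dim_vec x * dim_vec y * dim_vec z" by (simp add: mult.assoc)
  then have yz: "0 < dim_vec y * dim_vec z" by (auto intro: Nat.gr0I)
  have 1: "i div dim_vec z < dim_vec x * dim_vec y" using div_mod_less[OF i] by simp
  have 2: "i mod (dim_vec y * dim_vec z) < dim_vec y * dim_vec z" using yz by simp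
  have 3: "i mod (dim_vec y * dim_vec z) div dim_vec z = i div dim_vec z mod dim_vec y"
    "i mod (dim_vec y * dim_vec z) mod dim_vec z = i mod dim_vec z"
    by (simp_all add: mod_mult_div_mod)
  have "vkron (vkron x y) z $ i =
      x $ (i div dim_vec z div dim_vec y) * y $ (i div dim_vec z mod dim_vec y) * z $ (i mod dim_vec z)"
    using i 1 by (simp add: vkron_index)
  also have "i div dim_vec z div dim_vec y = i div (dim_vec y * dim_vec z)"
    by (simp add: div_mult2_eq mult.commute[of "dim_vec y"])
  finally show "vkron (vkron x y) z $ i = vkron x (vkron y z) $ i"
    using i 2 3 by (simp add: vkron_index mult.assoc)
qed simp

lemma vkron_smult: "vkron (c \<cdot>\<^sub>v x) (c' \<cdot>\<^sub>v y) = (c * c') \<cdot>\<^sub>v vkron x y"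
  by (rule eq_vecI) (auto simp: vkron_index dest!: div_mod_less)

lemma kron_outer: "kron (outer x) (outer y) = outer (vkron x y)"
  by (rule eq_matI) (auto simp: kron_def outer_def vkron_index dest!: div_mod_less)

lemma sum_split_index: "(\<Sum>i<a * b. f i) = (\<Sum>k<a. \<Sum>q<b. f (k * b + (q::nat)))"
  for f :: "nat \<Rightarrow> 'a::comm_monoid_add"
proof -
  have "(\<Sum>i<a * b. f i) = (\<Sum>k<a. sum f {k * b..<k * b + b})"
    by (rule sum.nat_group[symmetric])
  also have "\<dots> = (\<Sum>k<a. \<Sum>q<b. f (k * b + q))"
  proof (rule sum.cong)
    show "sum f {k * b..<k * b + b} = (\<Sum>q<b. f (k * b + q))" for k
      using sum.shift_bounds_nat_ivl[of f 0 "k * b" b] by (simp add: lessThan_atLeast0 add.commute)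
  qed simp
  finally show ?thesis .
qed

lemma vkron_index_add:
  assumes "i < dim_vec x" "k < dim_vec y"
  shows "vkron x y $ (i * dim_vec y + k) = x $ i * y $ k"
proof -
  have "(i * b + k) div b = i \<and> (i * b + k) mod b = k" if "k < b" for b
    using that by simp
  then have "(i * dim_vec y + k) div dim_vec y = i" "(i * dim_vec y + k) mod dim_vec y = k"
    using assms(2) by blast+
  then show ?thesis by (simp only: vkron_index[OF mult_add_less_mult[OF assms]])
qed

lemma mat_trace_outer_sum: "mat_trace (outer x) = (\<Sum>i<dim_vec x. x $ i * cnj (x $ i))"
  by (simp add: mat_trace_def outer_def)

lemma ptrace_snd_outer:
  assumes "x \<in> carrier_vec a" "y \<in> carrier_vec b"
  shows "ptrace_snd a b (outer (vkron x y)) = mat_trace (outer y) \<cdot>\<^sub>m outer x"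
proof (rule eq_matI)
  fix i j assume "i < dim_row (mat_trace (outer y) \<cdot>\<^sub>m outer x)"
    "j < dim_col (mat_trace (outer y) \<cdot>\<^sub>m outer x)"
  then have ij: "i < a" "j < a" using assms by (auto simp: outer_def)
  have "outer (vkron x y) $$ (i * b + k, j * b + k) = x $ i * cnj (x $ j) * (y $ k * cnj (y $ k))"
    if "k < b" for k
    using that ij assms vkron_index_add[of i x k y] vkron_index_add[of j x k y]
    by (auto simp: outer_def mult_add_less_mult)
  then show "ptrace_snd a b (outer (vkron x y)) $$ (i, j) = (mat_trace (outer y) \<cdot>\<^sub>m outer x) $$ (i, j)"
    using ij assms
    by (simp add: ptrace_snd_def sum_distrib_left[symmetric] mat_trace_outer_sum)
       (simp add: outer_def)
qed (use assms in \<open>auto simp: ptrace_snd_def outer_def\<close>)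

lemma ptrace_fst_outer:
  assumes "x \<in> carrier_vec a" "y \<in> carrier_vec b"
  shows "ptrace_fst a b (outer (vkron x y)) = mat_trace (outer x) \<cdot>\<^sub>m outer y"
proof (rule eq_matI)
  fix i j assume "i < dim_row (mat_trace (outer x) \<cdot>\<^sub>m outer y)"
    "j < dim_col (mat_trace (outer x) \<cdot>\<^sub>m outer y)"
  then have ij: "i < b" "j < b" using assms by (auto simp: outer_def)
  have "outer (vkron x y) $$ (k * b + i, k * b + j) = (x $ k * cnj (x $ k)) * (y $ i * cnj (y $ j))"
    if "k < a" for k
    using that ij assms vkron_index_add[of k x i y] vkron_index_add[of k x j y]
    by (auto simp: outer_def mult_add_less_mult)
  then show "ptrace_fst a b (outer (vkron x y)) $$ (i, j) = (mat_trace (outer x) \<cdot>\<^sub>m outer y) $$ (i, j)"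
    using ij assms
    by (simp add: ptrace_fst_def sum_distrib_right[symmetric] mat_trace_outer_sum)
       (simp add: outer_def)
qed (use assms in \<open>auto simp: ptrace_fst_def outer_def\<close>)

lemma mat_trace_outer_vkron:
  "mat_trace (outer (vkron x y)) = mat_trace (outer x) * mat_trace (outer y)"
proof -
  have "mat_trace (outer (vkron x y)) = (\<Sum>i<dim_vec x. \<Sum>k<dim_vec y.
      vkron x y $ (i * dim_vec y + k) * cnj (vkron x y $ (i * dim_vec y + k)))"
    by (simp add: mat_trace_outer_sum sum_split_index)
  also have "\<dots> = (\<Sum>i<dim_vec x. \<Sum>k<dim_vec y. (x $ i * cnj (x $ i)) * (y $ k * cnj (y $ k)))"
    by (intro sum.cong refl) (simp add: vkron_index_add)
  finally show ?thesis
    by (simp only: mat_trace_outer_sum sum_product)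
qed

text \<open>The mixed-product rule, which reduces the compression by \<open>Id \<otimes> \<Pi>\<close> to the second factor.\<close>

lemma kron_mult:
  assumes "A \<in> carrier_mat a a" "C \<in> carrier_mat a a" "B \<in> carrier_mat b b" "D \<in> carrier_mat b b"
  shows "kron A B * kron C D = kron (A * C) (B * D)"
proof (rule eq_matI)
  fix i j assume "i < dim_row (kron (A * C) (B * D))" "j < dim_col (kron (A * C) (B * D))"
  then have ij: "i < a * b" "j < a * b" using assms by (auto simp: kron_def)
  note ij' = div_mod_less[OF ij(1)] div_mod_less[OF ij(2)]
  have "(kron A B * kron C D) $$ (i, j) = (\<Sum>k<a * b. kron A B $$ (i, k) * kron C D $$ (k, j))"
    using ij assms kron_carrier[of A a B b] kron_carrier[of C a D b]
    by (simp add: scalar_prod_def lessThan_atLeast0)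
  also have "\<dots> = (\<Sum>k<a. \<Sum>q<b. kron A B $$ (i, k * b + q) * kron C D $$ (k * b + q, j))"
    by (rule sum_split_index)
  also have "\<dots> = (\<Sum>k<a. \<Sum>q<b. (A $$ (i div b, k) * C $$ (k, j div b)) *
      (B $$ (i mod b, q) * D $$ (q, j mod b)))"
    using ij assms by (intro sum.cong refl) (simp add: kron_def mult_add_less_mult)
  also have "\<dots> = (\<Sum>k<a. A $$ (i div b, k) * C $$ (k, j div b)) *
      (\<Sum>q<b. B $$ (i mod b, q) * D $$ (q, j mod b))"
    by (simp only: sum_product)
  also have "\<dots> = kron (A * C) (B * D) $$ (i, j)"
    using ij ij' assms by (simp add: kron_def scalar_prod_def lessThan_atLeast0)
  finally show "(kron A B * kron C D) $$ (i, j) = kron (A * C) (B * D) $$ (i, j)" .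
qed (use assms in \<open>auto simp: kron_def\<close>)

text \<open>Products over lists of indices serve all cases at once: the concatenation of leaf
  sequences at a node of a tree, the prefixes \<open>1, \<dots>, k\<close> of the recursive system, and
  tensor powers with modified factors.\<close>

primrec tensor :: "(nat \<Rightarrow> complex vec) \<Rightarrow> nat list \<Rightarrow> complex vec" where
  "tensor x [] = vec 1 (\<lambda>_. 1)"
| "tensor x (k # ks) = vkron (x k) (tensor x ks)"

lemma vkron_one_left: "vkron (vec 1 (\<lambda>_. 1)) x = x"
  by (rule eq_vecI) (auto simp: vkron_index)

lemma vkron_one_right: "vkron x (vec 1 (\<lambda>_. 1)) = x"
  by (rule eq_vecI) (auto simp: vkron_index)

text \<open>By associativity only the sequence of the factors matters, so the vector at the root of a tree does
  not depend on the shape of the tree.\<close>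

lemma tensor_append: "tensor x (ks @ ls) = vkron (tensor x ks) (tensor x ls)"
  by (induction ks) (simp_all add: vkron_assoc vkron_one_left del: One_nat_def)

lemma tensor_single: "tensor x [k] = x k"
  by (simp add: vkron_one_right del: One_nat_def)

lemma tensor_Suc: "tensor x [1..<Suc (Suc n)] = vkron (tensor x [1..<Suc n]) (x (Suc n))"
  using tensor_append[of x "[1..<Suc n]" "[Suc n]"] by (simp only: tensor_single) simp

lemma kron_upto_outer: "kron_upto (\<lambda>j. outer (x j)) n = outer (tensor x [1..<Suc n])"
proof (induction n)
  case 0
  show ?case by (auto simp: outer_def)
next
  case (Suc n)
  then show ?case by (simp only: kron_upto.simps kron_outer tensor_Suc)
qed

lemma dim_tensor: "dim_vec (tensor x ks) = (\<Prod>k\<leftarrow>ks. dim_vec (x k))"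
  by (induction ks) simp_all

lemma mat_trace_outer_tensor: "mat_trace (outer (tensor x ks)) = (\<Prod>k\<leftarrow>ks. mat_trace (outer (x k)))"
proof (induction ks)
  case Nil
  show ?case by (simp add: mat_trace_outer_sum)
qed (simp add: mat_trace_outer_vkron)

lemma tensor_smult: "tensor (\<lambda>k. c k \<cdot>\<^sub>v x k) ks = (\<Prod>k\<leftarrow>ks. c k) \<cdot>\<^sub>v tensor x ks"
  by (induction ks) (auto simp: vkron_smult)

lemma tensor_prefix_carrier:
  "(\<And>k. k \<in> {1..n} \<Longrightarrow> x k \<in> carrier_vec (d k)) \<Longrightarrow> tensor x [1..<Suc n] \<in> carrier_vec (prefix_dim d n)"
proof (induction n)
  case 0
  show ?case by (simp add: prefix_dim_def)
next
  case (Suc n)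
  then show ?case unfolding tensor_Suc prefix_dim_Suc by (intro vkron_carrier) auto
qed

lemma tensor_power_carrier:
  "(\<And>k. k \<in> {1..n} \<Longrightarrow> x k \<in> carrier_vec b) \<Longrightarrow> tensor x [1..<Suc n] \<in> carrier_vec (b ^ n)"
  using tensor_prefix_carrier[of n x "\<lambda>_. b"] by (simp add: prefix_dim_def)

lemma tensor_power_index:
  assumes "\<And>k. k \<in> {1..n} \<Longrightarrow> x k \<in> carrier_vec b" "i < b ^ n"
  shows "tensor x [1..<Suc n] $ i = (\<Prod>s=1..n. x s $ digit b n i s)"
  using assms
proof (induction n arbitrary: i)
  case (Suc n)
  have c: "tensor x [1..<Suc n] \<in> carrier_vec (b ^ n)" "x (Suc n) \<in> carrier_vec b"
    using Suc.prems by (auto intro!: tensor_power_carrier simp del: upt_Suc One_nat_def)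
  have i: "i < b ^ n * b" using Suc.prems by (simp add: mult.commute)
  have "tensor x [1..<Suc (Suc n)] $ i = tensor x [1..<Suc n] $ (i div b) * x (Suc n) $ (i mod b)"
    using c i vkron_index[of i "tensor x [1..<Suc n]" "x (Suc n)"] unfolding tensor_Suc by auto
  also have "tensor x [1..<Suc n] $ (i div b) = (\<Prod>s=1..n. x s $ digit b n (i div b) s)"
    using div_mod_less[OF i] Suc.prems by (intro Suc.IH) auto
  also have "\<dots> = (\<Prod>s=1..n. x s $ digit b (Suc n) i s)"
    by (intro prod.cong refl) (simp add: digit_Suc)
  finally show ?case by (simp add: digit_last)
qed simp


section \<open>Product states\<close>

text \<open>Permuting the factors permutes the digits of the index, and an entry of a tensor power is the
  product over the digits.\<close>

lemma tensor_power_sym: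
  assumes y: "y \<in> carrier_vec b"
  shows "tensor (\<lambda>_. y) [1..<Suc n] \<in> sym_subspace b n"
  unfolding sym_subspace_def
proof (safe)
  show c: "tensor (\<lambda>_. y) [1..<Suc n] \<in> carrier_vec (b ^ n)"
    using y by (rule tensor_power_carrier)
  fix \<sigma> assume \<sigma>: "\<sigma> permutes {1..n}"
  show "permute_factors b n \<sigma> (tensor (\<lambda>_. y) [1..<Suc n]) = tensor (\<lambda>_. y) [1..<Suc n]"
  proof (rule eq_vecI)
    fix i assume "i < dim_vec (tensor (\<lambda>_. y) [1..<Suc n])"
    then have i: "i < b ^ n" using c by auto
    have "permute_factors b n \<sigma> (tensor (\<lambda>_. y) [1..<Suc n]) $ i =
        (\<Prod>s=1..n. y $ digit b n (permute_digits b n \<sigma> i) s)"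
      unfolding permute_factors_index[OF i]
      by (rule tensor_power_index) (use y i in \<open>auto simp: permute_digits_less\<close>)
    also have "\<dots> = (\<Prod>s=1..n. y $ digit b n i (\<sigma> s))"
    proof (intro prod.cong refl)
      fix s assume s: "s \<in> {1..n}"
      have "digit b n (permute_digits b n \<sigma> i) s = digit b n i (\<sigma> s)"
        unfolding permute_digits_def by (rule digit_undigits[OF digit_less_base[OF i] s])
      then show "y $ digit b n (permute_digits b n \<sigma> i) s = y $ digit b n i (\<sigma> s)" by simp
    qed
    also have "\<dots> = (\<Prod>s=1..n. y $ digit b n i s)"
      using prod.permute[OF \<sigma>, of "\<lambda>s. y $ digit b n i s"] by (simp add: o_def)
    also have "\<dots> = tensor (\<lambda>_. y) [1..<Suc n] $ i"
      by (rule tensor_power_index[symmetric]) (use y i in auto)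
    finally show "permute_factors b n \<sigma> (tensor (\<lambda>_. y) [1..<Suc n]) $ i =
        tensor (\<lambda>_. y) [1..<Suc n] $ i" .
  qed (use c in \<open>auto simp: permute_factors_def\<close>)
qed

text \<open>Multiplication from the left uses that \<open>\<Pi>\<close> fixes symmetric tensors. From the right,
  orthogonality of \<open>v - \<Pi> v\<close> to \<open>z\<close> for basis vectors \<open>v\<close> gives \<open>z\<^sup>\<dagger> \<Pi> = z\<^sup>\<dagger>\<close>.\<close>

lemma sym_projector_outer:
  assumes z: "z \<in> sym_subspace b n"
  shows "sym_projector b n * outer z * sym_projector b n = outer z"
proof -
  let ?P = "sym_projector b n"
  have zc: "z \<in> carrier_vec (b ^ n)" using z by (simp add: sym_subspace_def)
  note P = sym_projector_carrier[of b n]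
  have left: "(\<Sum>k<b ^ n. ?P $$ (i, k) * z $ k) = z $ i" if "i < b ^ n" for i
    using mult_mat_vec_sum[OF P zc that] sym_projector_fixes[OF z] by simp
  have right: "(\<Sum>k<b ^ n. cnj (z $ k) * ?P $$ (k, j)) = cnj (z $ j)" if j: "j < b ^ n" for j
  proof -
    let ?e = "unit_vec (b ^ n) j :: complex vec"
    have e: "?e \<in> carrier_vec (b ^ n)" by simp
    have Pe: "?P *\<^sub>v ?e \<in> carrier_vec (b ^ n)" by (rule mult_mat_vec_carrier[OF P e])
    have "(?e - ?P *\<^sub>v ?e) \<bullet>c z = 0"
      using is_orth_projector_sym_projector[of b n] z by (auto simp: is_orth_projector_def)
    then have "(?P *\<^sub>v ?e) \<bullet>c z = ?e \<bullet>c z"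
      using e Pe zc by (simp add: minus_scalar_prod_distrib[of _ "b ^ n"])
    moreover have "?e \<bullet>c z = cnj (z $ j)"
      using zc j by (simp add: conjugate_complex_def)
    moreover have "(?P *\<^sub>v ?e) $ k = ?P $$ (k, j)" if "k < b ^ n" for k
      using that j P by simp
    ultimately show ?thesis
      using cscalar_prod_sum[OF Pe zc] by (simp add: mult.commute)
  qed
  have "?P * outer z = outer z"
  proof (rule eq_matI)
    fix i j assume "i < dim_row (outer z)" "j < dim_col (outer z)"
    then have ij: "i < b ^ n" "j < b ^ n" using zc by (auto simp: outer_def)
    have "(?P * outer z) $$ (i, j) = (\<Sum>k<b ^ n. ?P $$ (i, k) * (z $ k * cnj (z $ j)))"
      using ij P zc by (auto simp: outer_def scalar_prod_def lessThan_atLeast0)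
    also have "\<dots> = z $ i * cnj (z $ j)"
      by (simp only: mult.assoc[symmetric] sum_distrib_right[symmetric] left[OF ij(1)])
    finally show "(?P * outer z) $$ (i, j) = outer z $$ (i, j)"
      using ij zc by (simp add: outer_def)
  qed (use P zc in \<open>auto simp: outer_def\<close>)
  moreover have "outer z * ?P = outer z"
  proof (rule eq_matI)
    fix i j assume "i < dim_row (outer z)" "j < dim_col (outer z)"
    then have ij: "i < b ^ n" "j < b ^ n" using zc by (auto simp: outer_def)
    have "(outer z * ?P) $$ (i, j) = (\<Sum>k<b ^ n. z $ i * cnj (z $ k) * ?P $$ (k, j))"
      using ij P zc by (auto simp: outer_def scalar_prod_def lessThan_atLeast0)
    also have "\<dots> = z $ i * cnj (z $ j)"
      by (simp only: mult.assoc sum_distrib_left[symmetric] right[OF ij(2)])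
    finally show "(outer z * ?P) $$ (i, j) = outer z $$ (i, j)"
      using ij zc by (simp add: outer_def)
  qed (use P zc in \<open>auto simp: outer_def\<close>)
  ultimately show ?thesis by simp
qed

lemma outer_density: "x \<in> carrier_vec n \<Longrightarrow> mat_trace (outer x) = 1 \<Longrightarrow> outer x \<in> density n"
  by (simp add: density_def outer_herm psd_outer)

text \<open>At a transposed copy the tensor factor \<open>y y\<^sup>\<dagger>\<close> is transposed, which replaces \<open>y\<close> in it by its
  complex conjugate. On entries, both sides are
  products over the copies and agree factor by factor.\<close>

lemma ptranspose_outer_tensor_power:
  assumes x: "x \<in> carrier_vec a" and y: "y \<in> carrier_vec b"
  shows "ptranspose a b n I (outer (vkron x (tensor (\<lambda>_. y) [1..<Suc n]))) =
    outer (vkron x (tensor (\<lambda>s. if s \<in> I then conjugate y else y) [1..<Suc n]))"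
    (is "ptranspose a b n I (outer ?v) = outer ?w")
proof (rule eq_matI)
  let ?u = "\<lambda>s. if s \<in> I then conjugate y else y"
  have tc: "tensor (\<lambda>_. y) [1..<Suc n] \<in> carrier_vec (b ^ n)"
      "tensor ?u [1..<Suc n] \<in> carrier_vec (b ^ n)"
    using y by (auto intro!: tensor_power_carrier simp del: upt_Suc One_nat_def)
  have dim: "dim_vec x = a" "dim_vec (tensor (\<lambda>_. y) [1..<Suc n]) = b ^ n"
      "dim_vec (tensor ?u [1..<Suc n]) = b ^ n"
    using x tc by (auto simp del: upt_Suc)
  fix i j assume "i < dim_row (outer ?w)" "j < dim_col (outer ?w)"
  then have ij: "i < a * b ^ n" "j < a * b ^ n" using dim by (auto simp: outer_def)
  have b: "digit b n k s < b" if "s \<in> {1..n}" for k s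
    using that ij by (intro digit_less) (auto intro: Nat.gr0I simp: power_0_left)
  have v: "?v $ mix_digits b n I i j = x $ (i div b ^ n) *
      (\<Prod>s=1..n. y $ (if s \<in> I then digit b n j s else digit b n i s))"
    if ij: "i < a * b ^ n" "j < a * b ^ n" for i j
  proof -
    let ?r = "undigits b n (\<lambda>s. if s \<in> I then digit b n j s else digit b n i s)"
    have f: "(if s \<in> I then digit b n j s else digit b n i s) < b" if "s \<in> {1..n}" for s
      using b that by simp
    have r: "?r < b ^ n" by (rule undigits_less) (rule f)
    have "?v $ mix_digits b n I i j = x $ (i div b ^ n) * tensor (\<lambda>_. y) [1..<Suc n] $ ?r"
      using vkron_index_add[of "i div b ^ n" x ?r "tensor (\<lambda>_. y) [1..<Suc n]"]
        dim r div_mod_less[OF ij(1)] by (simp only: mix_digits_def)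
    also have "tensor (\<lambda>_. y) [1..<Suc n] $ ?r = (\<Prod>s=1..n. y $ digit b n ?r s)"
      by (rule tensor_power_index) (use y r in auto)
    also have "\<dots> = (\<Prod>s=1..n. y $ (if s \<in> I then digit b n j s else digit b n i s))"
      by (intro prod.cong refl arg_cong[where f = "\<lambda>k. y $ k"]) (rule digit_undigits[OF f])
    finally show ?thesis .
  qed
  have w: "?w $ i = x $ (i div b ^ n) *
      (\<Prod>s=1..n. if s \<in> I then cnj (y $ digit b n i s) else y $ digit b n i s)"
    if i: "i < a * b ^ n" for i
  proof -
    have "?w $ i = x $ (i div b ^ n) * tensor ?u [1..<Suc n] $ (i mod b ^ n)"
      using vkron_index[of i x "tensor ?u [1..<Suc n]"] dim i by (simp only:)
    also have "tensor ?u [1..<Suc n] $ (i mod b ^ n) = (\<Prod>s=1..n. ?u s $ digit b n (i mod b ^ n) s)"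
      by (rule tensor_power_index) (use y div_mod_less[OF i] in auto)
    also have "\<dots> = (\<Prod>s=1..n. if s \<in> I then cnj (y $ digit b n i s) else y $ digit b n i s)"
      by (intro prod.cong refl) (use b y in \<open>auto simp: digit_mod conjugate_complex_def\<close>)
    finally show ?thesis .
  qed
  have "ptranspose a b n I (outer ?v) $$ (i, j) =
      ?v $ mix_digits b n I i j * cnj (?v $ mix_digits b n I j i)"
    using ij dim by (simp add: ptranspose_def outer_def mix_digits_less del: upt_Suc)
  also have "\<dots> = x $ (i div b ^ n) * cnj (x $ (j div b ^ n)) *
      (\<Prod>s=1..n. y $ (if s \<in> I then digit b n j s else digit b n i s) *
         cnj (y $ (if s \<in> I then digit b n i s else digit b n j s)))"
    by (simp add: v[OF ij] v[OF ij(2) ij(1)] prod.distrib del: upt_Suc One_nat_def)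
  also have "(\<Prod>s=1..n. y $ (if s \<in> I then digit b n j s else digit b n i s) *
         cnj (y $ (if s \<in> I then digit b n i s else digit b n j s))) =
      (\<Prod>s=1..n. (if s \<in> I then cnj (y $ digit b n i s) else y $ digit b n i s) *
         cnj (if s \<in> I then cnj (y $ digit b n j s) else y $ digit b n j s))"
    by (intro prod.cong refl) simp
  also have "x $ (i div b ^ n) * cnj (x $ (j div b ^ n)) * \<dots> = ?w $ i * cnj (?w $ j)"
    by (simp add: w[OF ij(1)] w[OF ij(2)] prod.distrib del: upt_Suc One_nat_def)
  also have "\<dots> = outer ?w $$ (i, j)"
    using ij dim by (simp add: outer_def del: upt_Suc)
  finally show "ptranspose a b n I (outer ?v) $$ (i, j) = outer ?w $$ (i, j)" .
next
  have "dim_vec (tensor (\<lambda>s. if s \<in> I then conjugate y else y) [1..<Suc n]) = b ^ n"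
    using y tensor_power_carrier[of n "\<lambda>s. if s \<in> I then conjugate y else y" b]
    by (auto simp del: upt_Suc)
  then show "dim_row (ptranspose a b n I (outer ?v)) = dim_row (outer ?w)"
    "dim_col (ptranspose a b n I (outer ?v)) = dim_col (outer ?w)"
    using x by (auto simp: ptranspose_def outer_def simp del: upt_Suc)
qed

text \<open>The extension is the projector onto \<open>x \<otimes> y\<^sup>\<otimes>\<^sup>l\<close>.\<close>

lemma product_in_DPS:
  assumes x: "x \<in> carrier_vec a" "mat_trace (outer x) = 1"
    and y: "y \<in> carrier_vec b" "mat_trace (outer y) = 1" and l: "1 \<le> l"
  shows "outer (vkron x y) \<in> DPS l a b"
proof -
  let ?z = "tensor (\<lambda>_. y) [1..<Suc l]"
  let ?rest = "tensor (\<lambda>_. y) [2..<Suc l]"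
  let ?\<rho> = "outer (vkron x ?z)"
  have z: "?z \<in> sym_subspace b l" by (rule tensor_power_sym[OF y(1)])
  then have zc: "?z \<in> carrier_vec (b ^ l)" by (simp add: sym_subspace_def del: upt_Suc)
  \<comment> \<open>The first copy joins \<open>x\<close>; tracing out the others contributes their squared norm \<open>1\<close>.\<close>
  have split: "?z = vkron y ?rest"
    using l by (simp add: upt_conv_Cons numeral_2_eq_2 del: upt_Suc)
  have "dim_vec ?rest = b ^ (l - 1)"
    using y(1) by (simp add: dim_tensor map_replicate_const del: upt_Suc)
  moreover have "mat_trace (outer ?rest) = 1"
    unfolding mat_trace_outer_tensor y(2) by (simp add: map_replicate_const del: upt_Suc)
  ultimately have rest: "?rest \<in> carrier_vec (b ^ (l - 1))" "mat_trace (outer ?rest) = 1"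
    by (blast intro: carrier_vecI)+
  have P: "kron (1\<^sub>m a) (sym_projector b l) * ?\<rho> * kron (1\<^sub>m a) (sym_projector b l) = ?\<rho>"
  proof -
    note c = outer_carrier[OF x(1)] outer_carrier[OF zc] sym_projector_carrier[of b l]
    have "kron (1\<^sub>m a) (sym_projector b l) * kron (outer x) (outer ?z) * kron (1\<^sub>m a) (sym_projector b l)
        = kron (outer x) (sym_projector b l * outer ?z * sym_projector b l)"
      using c by (simp add: kron_mult[of _ a _ _ "b ^ l"] mult_carrier_mat[of _ "b ^ l" "b ^ l" _ "b ^ l"]
          del: upt_Suc)
    then show ?thesis
      unfolding kron_outer sym_projector_outer[OF z] .
  qed
  have "ptrace_snd (a * b) (b ^ (l - 1)) ?\<rho> = outer (vkron x y)"
    unfolding split vkron_assoc[symmetric]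
      ptrace_snd_outer[OF vkron_carrier[OF x(1) y(1)] rest(1)] rest(2)
    by auto
  moreover have "psd (ptranspose a b l I ?\<rho>)" for I
    unfolding ptranspose_outer_tensor_power[OF x(1) y(1)] by (rule psd_outer)
  moreover have "outer (vkron x y) \<in> density (a * b)"
    using x y by (intro outer_density vkron_carrier) (simp_all add: mat_trace_outer_vkron)
  moreover have "?\<rho> \<in> herm (a * b ^ l)"
    by (intro outer_herm vkron_carrier x zc)
  ultimately show ?thesis
    using P psd_outer[of "vkron x ?z"] unfolding DPS_def by blast
qed

lemma product_in_C_rec:
  assumes u: "\<And>k. k \<in> {1..m} \<Longrightarrow> u k \<in> carrier_vec (d k) \<and> mat_trace (outer (u k)) = 1"
    and "1 \<le> l" "1 \<le> m"
  shows "outer (tensor u [1..<Suc m]) \<in> C_rec d m l"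
proof -
  let ?Z = "\<lambda>k. outer (tensor u [1..<Suc k])" and ?X = "\<lambda>k. outer (u k)"
  have tc: "tensor u [1..<Suc k] \<in> carrier_vec (prefix_dim d k)" if "k \<le> m" for k
    using that u by (intro tensor_prefix_carrier) auto
  have tr: "mat_trace (?Z k) = 1" if "k \<le> m" for k
    using that
  proof (induction k)
    case 0
    show ?case by (simp add: mat_trace_outer_sum)
  next
    case (Suc k)
    then show ?case using u[of "Suc k"] unfolding tensor_Suc mat_trace_outer_vkron by auto
  qed
  have 1: "\<forall>k\<in>{1..m}. ?X k \<in> herm (d k) \<and> ?Z k \<in> herm (prefix_dim d k)"
    using u tc outer_herm by (metis atLeastAtMost_iff)
  have "[1..<Suc 1] = [1]" by simp
  then have 2: "?Z m = outer (tensor u [1..<Suc m])" "?Z 1 = ?X 1"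
    by (simp_all only: tensor_single)
  have 3: "\<forall>k\<in>{1..m}. psd (?X k) \<and> mat_trace (?X k) = 1"
    using u psd_outer by blast
  have 4: "\<forall>k\<in>{2..m}. mat_trace (?Z k) = 1 \<and> ?Z k \<in> DPS l (prefix_dim d (k - 1)) (d k) \<and>
      ptrace_snd (prefix_dim d (k - 1)) (d k) (?Z k) = ?Z (k - 1) \<and>
      ptrace_fst (prefix_dim d (k - 1)) (d k) (?Z k) = ?X k"
  proof
    fix k assume k: "k \<in> {2..m}"
    then obtain j where j: "k = Suc j" "j \<le> m" by (cases k) auto
    have uk: "u (Suc j) \<in> carrier_vec (d (Suc j))" "mat_trace (outer (u (Suc j))) = 1"
      using u[of k] k j by auto
    have "?Z (Suc j) \<in> DPS l (prefix_dim d j) (d (Suc j)) \<and>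
      ptrace_snd (prefix_dim d j) (d (Suc j)) (?Z (Suc j)) = ?Z j \<and>
      ptrace_fst (prefix_dim d j) (d (Suc j)) (?Z (Suc j)) = ?X (Suc j)"
      unfolding tensor_Suc ptrace_snd_outer[OF tc[OF j(2)] uk(1)] ptrace_fst_outer[OF tc[OF j(2)] uk(1)]
        tr[OF j(2)] uk(2)
      using product_in_DPS[OF tc[OF j(2)] tr[OF j(2)] uk assms(2)] by auto
    then show "mat_trace (?Z k) = 1 \<and> ?Z k \<in> DPS l (prefix_dim d (k - 1)) (d k) \<and>
      ptrace_snd (prefix_dim d (k - 1)) (d k) (?Z k) = ?Z (k - 1) \<and>
      ptrace_fst (prefix_dim d (k - 1)) (d k) (?Z k) = ?X k"
      using k j tr[of k] by (simp del: upt_Suc)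
  qed
  show ?thesis
    unfolding C_rec_def mem_Collect_eq
    by (rule exI[of _ ?X], rule exI[of _ ?Z], intro conjI; fact)
qed

text \<open>Passes the hypotheses on the leaves of the whole tree to each node.\<close>

lemma nodes_leaves_subset: "s \<in> nodes T \<Longrightarrow> set (leaves s) \<subseteq> set (leaves T)"
  by (induction T) auto

lemma product_in_C_tree:
  assumes u: "\<And>k. k \<in> set (leaves T) \<Longrightarrow> u k \<in> carrier_vec (d k) \<and> mat_trace (outer (u k)) = 1"
    and "1 \<le> l"
  shows "outer (tensor u (leaves T)) \<in> C_tree d T l"
proof -
  let ?Z = "\<lambda>s. outer (tensor u (leaves s))" and ?X = "\<lambda>k. outer (u k)"
  have node: "tensor u (leaves s) \<in> carrier_vec (node_dim d s) \<and> mat_trace (?Z s) = 1"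
    if "set (leaves s) \<subseteq> set (leaves T)" for s
    using that
  proof (induction s)
    case (Leaf k)
    then show ?case using u[of k] by (simp add: vkron_one_right del: One_nat_def)
  next
    case (Node A B)
    then show ?case by (simp add: tensor_append vkron_carrier mat_trace_outer_vkron)
  qed
  have 1: "\<forall>s\<in>nodes T. ?Z s \<in> herm (node_dim d s)" "\<forall>k\<in>set (leaves T). ?X k \<in> herm (d k)"
    using node nodes_leaves_subset outer_herm u by blast+
  have 2: "?Z T = outer (tensor u (leaves T))" "\<forall>k\<in>set (leaves T). ?Z (Leaf k) = ?X k"
    by (simp_all add: vkron_one_right del: One_nat_def)
  have 3: "\<forall>s\<in>nodes T. psd (?Z s) \<and> mat_trace (?Z s) = 1"
    using node nodes_leaves_subset psd_outer by blast
  have 4: "\<forall>A B. Node A B \<in> nodes T \<longrightarrow>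
      ?Z (Node A B) \<in> DPS l (node_dim d A) (node_dim d B) \<and>
      ptrace_fst (node_dim d A) (node_dim d B) (?Z (Node A B)) = ?Z B \<and>
      ptrace_snd (node_dim d A) (node_dim d B) (?Z (Node A B)) = ?Z A"
  proof (intro allI impI)
    fix A B assume "Node A B \<in> nodes T"
    then have "set (leaves A) \<subseteq> set (leaves T)" "set (leaves B) \<subseteq> set (leaves T)"
      using nodes_leaves_subset by fastforce+
    then have A: "tensor u (leaves A) \<in> carrier_vec (node_dim d A)" "mat_trace (?Z A) = 1"
      and B: "tensor u (leaves B) \<in> carrier_vec (node_dim d B)" "mat_trace (?Z B) = 1"
      using node by blast+
    show "?Z (Node A B) \<in> DPS l (node_dim d A) (node_dim d B) \<and>
      ptrace_fst (node_dim d A) (node_dim d B) (?Z (Node A B)) = ?Z B \<and>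
      ptrace_snd (node_dim d A) (node_dim d B) (?Z (Node A B)) = ?Z A"
      unfolding leaves.simps tensor_append ptrace_snd_outer[OF A(1) B(1)] ptrace_fst_outer[OF A(1) B(1)]
        A(2) B(2)
      using product_in_DPS[OF A B assms(2)] by auto
  qed
  show ?thesis
    unfolding C_tree_def mem_Collect_eq
    by (rule exI[of _ ?X], rule exI[of _ ?Z], intro conjI; fact)
qed


section \<open>Separable states are convex combinations of product states\<close>

text \<open>The division by \<open>s\<close> lets the induction leave off one summand without the weights having to sum
  to \<open>1\<close>. Membership in \<open>C\<close> is required for positive weights only: a term of weight zero in a separable
  decomposition may have a zero factor, to which no product of unit vectors corresponds.\<close>

lemma mat_convex_sum:
  fixes N :: nat and p :: "nat \<Rightarrow> real"
  assumes C: "mat_convex C" and Q: "\<And>i. i < N \<Longrightarrow> Q i \<in> carrier_mat n n"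
    and p: "\<And>i. i < N \<Longrightarrow> 0 \<le> p i" "\<And>i. i < N \<Longrightarrow> 0 < p i \<Longrightarrow> Q i \<in> C"
    and s: "(\<Sum>i<N. p i) = s" "0 < s"
  shows "mat n n (\<lambda>(r, c). \<Sum>i<N. complex_of_real (p i / s) * Q i $$ (r, c)) \<in> C"
  using assms(2-)
proof (induction N arbitrary: s)
  case (Suc N)
  let ?M = "\<lambda>N s. mat n n (\<lambda>(r, c). \<Sum>i<N. complex_of_real (p i / s) * Q i $$ (r, c))"
  define s' where "s' = (\<Sum>i<N. p i)"
  have s: "s = s' + p N" using Suc.prems by (simp add: s'_def)
  have s'0: "0 \<le> s'" using Suc.prems by (auto simp: s'_def intro!: sum_nonneg)
  have IH: "?M N s' \<in> C" if "0 < s'"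
    using Suc.prems that by (intro Suc.IH) (auto simp: s'_def)
  have pN: "0 \<le> p N" using Suc.prems by simp
  consider "p N = 0" | "0 < p N" "s' = 0" | "0 < p N" "0 < s'"
    using pN s'0 by fastforce
  then show ?case
  proof cases
    case 1
    then have "?M (Suc N) s = ?M N s'" using s by auto
    moreover have "?M N s' \<in> C" using IH 1 s \<open>0 < s\<close> by (simp only: add_0_right)
    ultimately show ?thesis by (simp only:)
  next
    case 2
    have "p i = 0" if "i < N" for i
      using 2(2) that Suc.prems(2) sum_nonneg_eq_0_iff[of "{..<N}" p]
      by (auto simp: s'_def less_Suc_eq)
    then have "?M (Suc N) s = Q N"
      using 2 s Suc.prems(1)[of N] by (intro eq_matI) auto
    moreover have "Q N \<in> C" using 2 Suc.prems(3) by simp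
    ultimately show ?thesis by (simp only:)
  next
    case 3
    \<comment> \<open>The last summand enters with weight \<open>p N / s\<close> into a mixture with the normalised sum of the others.\<close>
    have t: "0 \<le> p N / s" "p N / s \<le> 1" "1 - p N / s = s' / s"
      using 3 s \<open>0 < s\<close> by (auto simp: field_simps)
    have "?M (Suc N) s = mix (p N / s) (?M N s') (Q N)"
    proof (rule eq_matI)
      fix r c assume "r < dim_row (mix (p N / s) (?M N s') (Q N))"
        "c < dim_col (mix (p N / s) (?M N s') (Q N))"
      then have rc: "r < n" "c < n" using Suc.prems(1)[of N] by (auto simp: mix_def)
      have "complex_of_real (s' / s) * (\<Sum>i<N. complex_of_real (p i / s') * Q i $$ (r, c)) =
          (\<Sum>i<N. complex_of_real (p i / s) * Q i $$ (r, c))"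
        using 3 by (auto simp: sum_distrib_left intro!: sum.cong)
      then show "?M (Suc N) s $$ (r, c) = mix (p N / s) (?M N s') (Q N) $$ (r, c)"
        using rc Suc.prems(1)[of N] t(3) by (simp add: mix_index[of _ n n])
    qed (use Suc.prems(1)[of N] in \<open>auto simp: mix_def\<close>)
    moreover have "mix (p N / s) (?M N s') (Q N) \<in> C"
      using C IH[OF 3(2)] Suc.prems(3)[OF _ 3(1)] t(1,2) unfolding mat_convex_iff by blast
    ultimately show ?thesis by (simp only:)
  qed
qed simp

text \<open>A product of vectors is nonzero exactly when all its factors are, and then each of them can be
  divided by its norm. The scalars removed multiply up to the squared norm of the whole product.\<close>

lemma normalize_product:
  assumes x: "\<And>k. k \<in> {1..m} \<Longrightarrow> x k \<in> carrier_vec (d k)"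
    and nz: "mat_trace (outer (tensor x [1..<Suc m])) \<noteq> 0"
  obtains u where "\<And>k. k \<in> {1..m} \<Longrightarrow> u k \<in> carrier_vec (d k) \<and> mat_trace (outer (u k)) = 1"
    and "outer (tensor x [1..<Suc m]) =
      mat_trace (outer (tensor x [1..<Suc m])) \<cdot>\<^sub>m outer (tensor u [1..<Suc m])"
proof -
  define r where "r k = (\<Sum>i<dim_vec (x k). (cmod (x k $ i))\<^sup>2)" for k
  define c where "c k = complex_of_real (1 / sqrt (r k))" for k
  define u where "u k = c k \<cdot>\<^sub>v x k" for k
  have tr: "mat_trace (outer (x k)) = complex_of_real (r k)" for k
    unfolding r_def by (rule mat_trace_outer)
  have r: "0 < r k" if k: "k \<in> {1..m}" for k
  proof -
    have "complex_of_real (r k) \<noteq> 0"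
      using nz k unfolding mat_trace_outer_tensor tr prod_list_zero_iff by force
    moreover have "0 \<le> r k" unfolding r_def by (intro sum_nonneg) simp
    ultimately show ?thesis by simp
  qed
  have cc: "c k * cnj (c k) = 1 / complex_of_real (r k)" if "k \<in> {1..m}" for k
    using r[OF that] by (simp add: c_def flip: of_real_mult)
  have 1: "u k \<in> carrier_vec (d k) \<and> mat_trace (outer (u k)) = 1" if k: "k \<in> {1..m}" for k
    using x[OF k] r[OF k] cc[OF k]
    by (simp add: u_def outer_smult mat_trace_smult[OF outer_carrier[OF x[OF k]]] tr)
  let ?v = "tensor x [1..<Suc m]" and ?c = "\<Prod>k\<leftarrow>[1..<Suc m]. c k"
  have "outer (tensor u [1..<Suc m]) = (?c * cnj ?c) \<cdot>\<^sub>m outer ?v"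
    unfolding u_def tensor_smult by (rule outer_smult)
  moreover have "?c * cnj ?c * mat_trace (outer ?v) = 1"
  proof -
    have "?c * cnj ?c * mat_trace (outer ?v) = mat_trace (outer (tensor u [1..<Suc m]))"
      unfolding u_def tensor_smult outer_smult
      by (rule mat_trace_smult[OF outer_carrier[OF tensor_prefix_carrier[OF x]], symmetric])
    also have "\<dots> = (\<Prod>k\<leftarrow>[1..<Suc m]. 1)"
      unfolding mat_trace_outer_tensor
      by (intro arg_cong[where f = prod_list] map_cong refl) (use 1 in auto)
    finally show ?thesis by (simp add: map_replicate_const del: upt_Suc)
  qed
  moreover have "t \<cdot>\<^sub>m (q \<cdot>\<^sub>m A) = A" if "q * t = 1" for q t :: complex and A
  proof (rule eq_matI)
    have "t * (q * a) = a" for a using that by (metis mult.assoc mult.commute mult_1)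
    then show "(t \<cdot>\<^sub>m (q \<cdot>\<^sub>m A)) $$ (i, j) = A $$ (i, j)" if "i < dim_row A" "j < dim_col A" for i j
      using that by simp
  qed simp_all
  ultimately have "mat_trace (outer ?v) \<cdot>\<^sub>m outer (tensor u [1..<Suc m]) = outer ?v"
    by (simp only:)
  note 2 = this[symmetric]
  show ?thesis by (rule that[OF 1 2])
qed

text \<open>The weight of a product term is its trace, and the trace condition on the separable state says that
  these weights sum to \<open>1\<close>.\<close>

lemma Sep_subset_convex:
  assumes C: "mat_convex C"
    and pure: "\<And>u. (\<And>k. k \<in> {1..m} \<Longrightarrow> u k \<in> carrier_vec (d k) \<and> mat_trace (outer (u k)) = 1) \<Longrightarrow>
      outer (tensor u [1..<Suc m]) \<in> C"
  shows "Sep d m \<subseteq> C"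
proof
  let ?n = "prefix_dim d m"
  fix W assume "W \<in> Sep d m"
  then obtain N :: nat and x :: "nat \<Rightarrow> nat \<Rightarrow> complex vec"
    where x: "\<forall>i<N. \<forall>j\<in>{1..m}. x i j \<in> carrier_vec (d j)"
    and W: "W = mat ?n ?n (\<lambda>(r, s). \<Sum>i<N. outer (tensor (x i) [1..<Suc m]) $$ (r, s))"
    and tr: "mat_trace W = 1"
    unfolding Sep_def sep_cone_def kron_upto_outer by blast
  define v where "v i = tensor (x i) [1..<Suc m]" for i
  define p where "p i = (\<Sum>k<dim_vec (v i). (cmod (v i $ k))\<^sup>2)" for i
  have p0: "0 \<le> p i" for i unfolding p_def by (intro sum_nonneg) simp
  have trv: "mat_trace (outer (v i)) = complex_of_real (p i)" for i
    unfolding p_def by (rule mat_trace_outer)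
  have vc: "v i \<in> carrier_vec ?n" if "i < N" for i
    unfolding v_def using x that by (intro tensor_prefix_carrier) auto
  have "\<exists>Q. Q \<in> carrier_mat ?n ?n \<and> (0 < p i \<longrightarrow> Q \<in> C) \<and>
      outer (v i) = complex_of_real (p i) \<cdot>\<^sub>m Q" if i: "i < N" for i
  proof (cases "p i = 0")
    case True
    then have "outer (v i) = 0\<^sub>m ?n ?n"
      using mat_trace_outer_eq_0[of "v i"] trv vc[OF i] by simp
    then show ?thesis using True by (intro exI[of _ "0\<^sub>m ?n ?n"]) auto
  next
    case False
    have xi: "x i k \<in> carrier_vec (d k)" if "k \<in> {1..m}" for k
      using x i that by blast
    have nz: "mat_trace (outer (tensor (x i) [1..<Suc m])) \<noteq> 0"
      using False trv[of i] unfolding v_def by (simp only: of_real_eq_0_iff not_False_eq_True)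
    obtain u where u: "\<And>k. k \<in> {1..m} \<Longrightarrow> u k \<in> carrier_vec (d k) \<and> mat_trace (outer (u k)) = 1"
      and eq: "outer (v i) = mat_trace (outer (v i)) \<cdot>\<^sub>m outer (tensor u [1..<Suc m])"
      unfolding v_def by (rule normalize_product[of m "x i" d, OF xi nz]) blast+
    have "outer (tensor u [1..<Suc m]) \<in> carrier_mat ?n ?n"
      using u by (intro outer_carrier tensor_prefix_carrier) blast
    moreover have "outer (tensor u [1..<Suc m]) \<in> C" by (rule pure[OF u])
    ultimately show ?thesis using eq unfolding trv by blast
  qed
  then obtain Q where Q: "\<And>i. i < N \<Longrightarrow> Q i \<in> carrier_mat ?n ?n"
    "\<And>i. i < N \<Longrightarrow> 0 < p i \<Longrightarrow> Q i \<in> C"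
    "\<And>i. i < N \<Longrightarrow> outer (v i) = complex_of_real (p i) \<cdot>\<^sub>m Q i"
    by metis
  have "mat_trace W = (\<Sum>r<?n. \<Sum>i<N. outer (v i) $$ (r, r))"
    by (simp add: W mat_trace_def v_def del: upt_Suc)
  also have "\<dots> = (\<Sum>i<N. \<Sum>r<?n. outer (v i) $$ (r, r))"
    by (rule sum.swap)
  also have "\<dots> = (\<Sum>i<N. mat_trace (outer (v i)))"
  proof (rule sum.cong[OF refl])
    fix i assume "i \<in> {..<N}"
    then have "dim_row (outer (v i)) = ?n" using vc[THEN outer_carrier] by blast
    then show "(\<Sum>r<?n. outer (v i) $$ (r, r)) = mat_trace (outer (v i))"
      by (simp only: mat_trace_def)
  qed
  also have "\<dots> = complex_of_real (\<Sum>i<N. p i)" by (simp add: trv)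
  finally have sum1: "(\<Sum>i<N. p i) = 1" using tr by (metis of_real_eq_1_iff)
  have "W = mat ?n ?n (\<lambda>(r, c). \<Sum>i<N. complex_of_real (p i / 1) * Q i $$ (r, c))"
    unfolding W v_def[symmetric]
  proof (rule eq_matI, goal_cases)
    case (1 r c)
    then have rc: "r < ?n" "c < ?n" by auto
    have "outer (v i) $$ (r, c) = complex_of_real (p i) * Q i $$ (r, c)" if "i < N" for i
      using Q(1,3)[OF that] rc by simp
    then show ?case using rc by simp
  qed auto
  also have "\<dots> \<in> C"
    by (rule mat_convex_sum[OF C Q(1) p0 Q(2) sum1]) auto
  finally show "W \<in> C" .
qed

theorem proposition6:
  fixes d :: "nat \<Rightarrow> nat" and m l :: nat
  assumes "m \<ge> 1" and "l \<ge> 1"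
  shows "(mat_convex (C_rec d m l) \<and> Sep d m \<subseteq> C_rec d m l) \<and>
         (\<forall>T :: dtree. leaves T = [1..<Suc m] \<longrightarrow>
            mat_convex (C_tree d T l) \<and> Sep d m \<subseteq> C_tree d T l)"
proof (intro conjI allI impI)
  show rec: "mat_convex (C_rec d m l)" using assms(2) by (rule mat_convex_C_rec)
  show "Sep d m \<subseteq> C_rec d m l"
    using rec by (rule Sep_subset_convex) (rule product_in_C_rec[OF _ assms(2,1)])
next
  fix T assume T: "leaves T = [1..<Suc m]"
  show tree: "mat_convex (C_tree d T l)" using assms(2) by (rule mat_convex_C_tree)
  have leaf: "set (leaves T) = {1..m}" unfolding T by auto
  show "Sep d m \<subseteq> C_tree d T l"
    using tree by (rule Sep_subset_convex) (rule product_in_C_tree[of T, unfolded leaf, unfolded T, OF _ assms(2)])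
qed

end
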